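(* Let $n$ be a positive integer, let $1\le k\le n$, let $x=(x_1,\ldots,x_n)$ and $y=(y_1,y_2,\ldots)$ be two sets of variables, and let $\beta$ be a further variable. For every partition $\lambda=(\lambda_1,\lambda_2,\ldots,\lambda_k)$ (with $\lambda_1\ge\cdots\ge\lambda_k\ge 0$) we have $$G_{(\lambda_1-n+k,\lambda_2-n+k,\ldots,\lambda_k-n+k)}(x|y)=\sum_{S\in\binom{[n]}{k}} G_{(\lambda_1,\lambda_2,\ldots,\lambda_k)}(x_S|y)\,\frac{\prod_{j\in\overline{S}}(1+\beta x_j)^k}{\prod_{i\in S}\prod_{j\in\overline{S}}(x_i-x_j)},$$ where the left-hand side is zero in the case $\lambda_k-n+k<0$.
   Context: The identity is one of rational functions in the variables $x_1,\ldots,x_n$, $y_1,y_2,\ldots$ and $\beta$. Write $[n]=\{1,\ldots,n\}$, let $\binom{[n]}{k}$ be the set of $k$-element subsets of $[n]$, and $\overline{S}=[n]\setminus S$. For $S=\{i_1<i_2<\cdots<i_k\}$ put $x_S=(x_{i_1},\ldots,x_{i_k})$. Empty products equal $1$. A partition $\lambda=(\lambda_1,\ldots,\lambda_\ell)$ is a weakly decreasing sequence of nonnegative integers, with $|\lambda|=\sum_i\lambda_i$; it is identified with its Young diagram, which has $\lambda_i$ left-justified squares in row $i$ (trailing zeros are immaterial). The square in row $i$ and column $j$ is $\alpha=(i,j)$, and its content is $c(\alpha)=j-i$. A set-valued tableau $T$ of shape $\lambda$ assigns to each square $\alpha$ a finite nonempty set $T(\alpha)$ of positive integers such that the sets weakly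 increase along each row and strictly increase down each column, where $A\le B$ means $\max A\le\min B$ and $A<B$ means $\max A<\min B$. Put $|T|=\sum_{\alpha\in\lambda}|T(\alpha)|$. Let $\mathcal{T}(\lambda,n)$ be the set of set-valued tableaux of shape $\lambda$ all of whose sets are subsets of $[n]$. Let $x_i\oplus y_j=x_i+y_j+\beta x_iy_j$. The factorial Grothendieck polynomial in $n$ variables $x=(x_1,\ldots,x_n)$ is $$G_\lambda(x|y)=\sum_{T\in\mathcal{T}(\lambda,n)}\beta^{|T|-|\lambda|}\prod_{\alpha\in\lambda}\prod_{t\in T(\alpha)}\left(x_t\oplus y_{t+c(\alpha)}\right).$$ $G_\lambda(x_S|y)$ denotes the same polynomial in the $k$ variables $x_S$, i.e. with $n$ replaced by $k$ and $x_t$ replaced by $x_{i_t}$ for $1\le t\le k$ (the $y$ variables are unchanged).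
   Formalization: When λ_k−n+k<0, the vanishing of the left-hand side is asserted only for β=0; for β a variable the printed claim fails in every such case (e.g. n=2, k=1, λ=(0): the right-hand side is −β, not 0). *)

theory Defs
  imports Main
begin

text \<open>
  A partition is a weakly decreasing list; row and column indices start at 1, so the part
  \<open>\<lambda>\<^sub>i\<close> is \<open>lam ! (i - 1)\<close>. Trailing zeros are allowed.
\<close>

definition is_partition :: "nat list \<Rightarrow> bool" where
  "is_partition lam \<longleftrightarrow> sorted_wrt (\<ge>) lam"

definition diagram :: "nat list \<Rightarrow> (nat \<times> nat) set" where
  "diagram lam = {(i, j). 1 \<le> i \<and> i \<le> length lam \<and> 1 \<le> j \<and> j \<le> lam ! (i - 1)}"

definition content :: "nat \<times> nat \<Rightarrow> int" where
  "content \<alpha> = int (snd \<alpha>) - int (fst \<alpha>)"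

text \<open>
  A tableau is a function on all pairs that is \<open>{}\<close> off the diagram, so that equality of
  tableaux is equality of functions and every \<open>svt lam n\<close> is finite.
\<close>

definition set_valued_tableau :: "nat list \<Rightarrow> (nat \<times> nat \<Rightarrow> nat set) \<Rightarrow> bool" where
  "set_valued_tableau lam T \<longleftrightarrow>
     (\<forall>\<alpha>\<in>diagram lam. finite (T \<alpha>) \<and> T \<alpha> \<noteq> {} \<and> (\<forall>t\<in>T \<alpha>. 0 < t)) \<and>
     (\<forall>\<alpha>. \<alpha> \<notin> diagram lam \<longrightarrow> T \<alpha> = {}) \<and>
     (\<forall>i j j'. (i, j) \<in> diagram lam \<longrightarrow> (i, j') \<in> diagram lam \<longrightarrow> j < j' \<longrightarrow>
        Max (T (i, j)) \<le> Min (T (i, j'))) \<and>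
     (\<forall>i i' j. (i, j) \<in> diagram lam \<longrightarrow> (i', j) \<in> diagram lam \<longrightarrow> i < i' \<longrightarrow>
        Max (T (i, j)) < Min (T (i', j)))"

definition svt :: "nat list \<Rightarrow> nat \<Rightarrow> (nat \<times> nat \<Rightarrow> nat set) set" where
  "svt lam n = {T. set_valued_tableau lam T \<and> (\<forall>\<alpha>\<in>diagram lam. T \<alpha> \<subseteq> {1..n})}"

definition tableau_size :: "nat list \<Rightarrow> (nat \<times> nat \<Rightarrow> nat set) \<Rightarrow> nat" where
  "tableau_size lam T = (\<Sum>\<alpha>\<in>diagram lam. card (T \<alpha>))"

definition oplus :: "'a::field \<Rightarrow> 'a \<Rightarrow> 'a \<Rightarrow> 'a" where
  "oplus \<beta> a b = a + b + \<beta> * a * b"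

text \<open>
  For a tableau of partition shape, an entry \<open>t\<close> in row \<open>i\<close> is at least \<open>i\<close>, so
  \<open>t + content \<alpha> \<ge> 1\<close> and \<open>nat\<close> below does not truncate; \<open>y 0\<close> is never used.
  Likewise the size of a tableau is at least \<open>sum_list lam\<close>, so the exponent of
  \<open>\<beta>\<close> is a true difference.
\<close>

definition grothendieck ::
    "'a::field \<Rightarrow> nat \<Rightarrow> nat list \<Rightarrow> (nat \<Rightarrow> 'a) \<Rightarrow> (nat \<Rightarrow> 'a) \<Rightarrow> 'a" where
  "grothendieck \<beta> n lam x y =
     (\<Sum>T\<in>svt lam n. \<beta> ^ (tableau_size lam T - sum_list lam) *
        (\<Prod>\<alpha>\<in>diagram lam. \<Prod>t\<in>T \<alpha>. oplus \<beta> (x t) (y (nat (int t + content \<alpha>)))))"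

definition subvars :: "(nat \<Rightarrow> 'a) \<Rightarrow> nat set \<Rightarrow> nat \<Rightarrow> 'a" where
  "subvars x S t = x (sorted_list_of_set S ! (t - 1))"

lemma finite_diagram [simp]: "finite (diagram lam)"
proof -
  have "diagram lam \<subseteq> (SIGMA i:{1..length lam}. {1..lam ! (i - 1)})"
    by (auto simp: diagram_def)
  then show ?thesis
    by (rule finite_subset) auto
qed

lemma finite_svt [simp]: "finite (svt lam n)"
proof -
  have "svt lam n \<subseteq> {T. \<forall>\<alpha>. (\<alpha> \<in> diagram lam \<longrightarrow> T \<alpha> \<in> Pow {1..n}) \<and>
                           (\<alpha> \<notin> diagram lam \<longrightarrow> T \<alpha> = {})}"
    unfolding svt_def set_valued_tableau_def by blast
  moreover have "finite {T. \<forall>\<alpha>. (\<alpha> \<in> diagram lam \<longrightarrow> T \<alpha> \<in> Pow {1..n}) \<and>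
                           (\<alpha> \<notin> diagram lam \<longrightarrow> T \<alpha> = {})}"
    by (rule finite_set_of_finite_funs) simp_all
  ultimately show ?thesis
    by (rule finite_subset)
qed

end

theory Submission
  imports Defs
begin

text \<open>
  The idea is that both sides are the same determinant divided by a Vandermonde product. Write
  \<open>[a|y]\<^sup>m = (a \<oplus> y\<^sub>1) \<dots> (a \<oplus> y\<^sub>m)\<close>. For a partition with \<open>n\<close> parts,

  \<open>G\<^sub>\<lambda>(x|y) = det ([x\<^sub>i|y]\<^bsup>\<lambda>\<^sub>j + n - j\<^esup> (1 + \<beta> x\<^sub>i)\<^bsup>j - 1\<^esup>) / (\<Prod>i<j. x\<^sub>i - x\<^sub>j)\<close>

  (\<open>grothendieck_bialternant\<close>). Granting this, take the determinant of size \<open>n\<close> for the partition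
  \<open>(\<lambda>\<^sub>1 - n + k, \<dots>, \<lambda>\<^sub>k - n + k, 0, \<dots>, 0)\<close> and expand it by Laplace along its first \<open>k\<close> columns
  (\<open>bialternant_append\<close>). The exponents in these columns are \<open>\<lambda>\<^sub>j + k - j\<close>, so the minor with rows
  \<open>S\<close> gives \<open>G\<^sub>\<lambda>(x\<^sub>S|y)\<close>. The complementary minor is \<open>\<Prod>j\<notin>S. (1 + \<beta> x\<^sub>j)\<^sup>k\<close> times the one for the
  empty partition in the other variables, and the part of the Vandermonde product that mixes \<open>S\<close>
  and its complement is the denominator. If \<open>\<lambda>\<^sub>k < n - k\<close> and \<open>\<beta> = 0\<close>, the \<open>k\<close>-th column is
  repeated among the last \<open>n - k\<close> ones, so that the sum vanishes.

  The determinantal formula is proved by induction on the number of variables, by showing that both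
  sides satisfy the same recursion in the last variable \<open>z\<close>. For the tableaux
  (\<open>grothendieck_branching\<close>), deleting the largest entry leaves a tableau whose shape \<open>\<mu>\<close>
  interlaces with \<open>\<lambda>\<close>, and the deleted occurrences are all squares of \<open>\<lambda>/\<mu>\<close> and an arbitrary set of
  row ends of \<open>\<mu>\<close> with no square of \<open>\<lambda>\<close> below them; so the weight of the step from \<open>\<mu>\<close> to
  \<open>\<lambda>\<close> is a product over the rows. For the
  determinants (\<open>bialternant_branching\<close>), the sum over all \<open>\<mu>\<close> may therefore be taken inside each
  column, where it telescopes (\<open>factorial_power_telescope\<close>): multiplied by \<open>a - z\<close> it
  becomes \<open>(1 + \<beta> z) C\<^sub>j - F\<^sub>j C\<^sub>j\<^sub>+\<^sub>1\<close>, where \<open>C\<^sub>j\<close> are the columns for \<open>\<lambda>\<close> and \<open>F\<^sub>j\<close> is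
  a constant. Up to a factorial power of \<open>z\<close>, the determinant of these combinations is the
  expansion of the determinant for \<open>\<lambda>\<close> along the row of \<open>z\<close>.
\<close>

section \<open>Quotients of alternants by Vandermonde products\<close>

text \<open>
  For functions \<open>C\<^sub>1, \<dots>, C\<^sub>m\<close> and an \<open>m\<close>-element set \<open>S = {a\<^sub>1, \<dots>, a\<^sub>m}\<close> this is
  \<open>det (C\<^sub>j a\<^sub>i) / (\<Prod>i<j. a\<^sub>i - a\<^sub>j)\<close>, written as the sum over all orderings of \<open>S\<close> of
  \<open>(\<Prod>j. C\<^sub>j a\<^sub>j) / (\<Prod>i<j. a\<^sub>i - a\<^sub>j)\<close>. Numerator and denominator of the quotient change sign
  together when \<open>S\<close> is reordered, so no permutation signs occur and the value depends on the set
  \<open>S\<close> alone.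
\<close>
primrec bialternant :: "('a::field \<Rightarrow> 'a) list \<Rightarrow> 'a set \<Rightarrow> 'a" where
  "bialternant [] S = 1"
| "bialternant (C # Cs) S = (\<Sum>a\<in>S. C a / (\<Prod>b\<in>S - {a}. a - b) * bialternant Cs (S - {a}))"

text \<open>
  Laplace expansion along the block of the first columns. Sorting the orderings of \<open>S\<close> by the set
  \<open>A\<close> of their first \<open>length Cs\<close> members splits the Vandermonde product into those of \<open>A\<close> and
  of \<open>S - A\<close> and the mixed product, which accounts for the denominator in the summation
  formula over subsets.
\<close>
lemma bialternant_append:
  assumes "finite S"
  shows "bialternant (Cs @ Ds) S =
    (\<Sum>A | A \<subseteq> S \<and> card A = length Cs.
      bialternant Cs A * bialternant Ds (S - A) / (\<Prod>a\<in>A. \<Prod>b\<in>S - A. a - b))"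
  using assms
proof (induction Cs arbitrary: S)
  case Nil
  have "{A. A \<subseteq> S \<and> card A = 0} = {{}}"
    using Nil by (auto dest: finite_subset)
  then show ?case by simp
next
  case (Cons C Cs)
  define t where "t S A = bialternant Cs A * bialternant Ds (S - A) / (\<Prod>a\<in>A. \<Prod>b\<in>S - A. a - b)" for S A
  have fin: "finite {A. A \<subseteq> S \<and> card A = k}" for k
    using Cons.prems by (auto intro: finite_subset[of _ "Pow S"])
  have step: "C a / (\<Prod>b\<in>S - {a}. a - b) * t (S - {a}) (A - {a}) =
      C a / (\<Prod>b\<in>A - {a}. a - b) * bialternant Cs (A - {a}) * bialternant Ds (S - A) /
        (\<Prod>a\<in>A. \<Prod>b\<in>S - A. a - b)"
    if "A \<subseteq> S" "a \<in> A" for a A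
  proof -
    have fA: "finite A" using that Cons.prems finite_subset by blast
    have 1: "S - {a} - (A - {a}) = S - A" using that by auto
    have "S - {a} = (A - {a}) \<union> (S - A)" using that by auto
    then have 2: "(\<Prod>b\<in>S - {a}. a - b) = (\<Prod>b\<in>A - {a}. a - b) * (\<Prod>b\<in>S - A. a - b)"
      using fA Cons.prems by (auto intro!: prod.union_disjoint)
    have 3: "(\<Prod>a\<in>A. \<Prod>b\<in>S - A. a - b) =
        (\<Prod>b\<in>S - A. a - b) * (\<Prod>a\<in>A - {a}. \<Prod>b\<in>S - A. a - b)"
      using fA that by (simp add: prod.remove)
    show ?thesis unfolding t_def 1 2 3 by (simp add: divide_inverse mult_ac)
  qed
  have "bialternant ((C # Cs) @ Ds) S =
      (\<Sum>a\<in>S. \<Sum>A | A \<subseteq> S - {a} \<and> card A = length Cs.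
        C a / (\<Prod>b\<in>S - {a}. a - b) * t (S - {a}) A)"
    using Cons by (simp add: t_def sum_distrib_left)
  also have "\<dots> = (\<Sum>(a, A)\<in>(SIGMA a:S. {A. A \<subseteq> S - {a} \<and> card A = length Cs}).
      C a / (\<Prod>b\<in>S - {a}. a - b) * t (S - {a}) A)"
    using Cons.prems by (subst sum.Sigma) (auto intro: finite_subset[of _ "Pow S"])
  \<comment> \<open>A first element followed by a set is a set with a marked element.\<close>
  also have "\<dots> = (\<Sum>(A, a)\<in>(SIGMA A:{A. A \<subseteq> S \<and> card A = length (C # Cs)}. A).
      C a / (\<Prod>b\<in>S - {a}. a - b) * t (S - {a}) (A - {a}))"
  proof (rule sum.reindex_bij_witness[where i = "\<lambda>(A, a). (a, A - {a})" and j = "\<lambda>(a, A). (insert a A, a)"])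
    fix p assume "p \<in> (SIGMA a:S. {A. A \<subseteq> S - {a} \<and> card A = length Cs})"
    then obtain a A where p: "p = (a, A)" "a \<in> S" "A \<subseteq> S - {a}" "card A = length Cs" by auto
    then have "a \<notin> A" "finite A" using Cons.prems finite_subset[of A S] by auto
    with p show "(case case p of (a, A) \<Rightarrow> (insert a A, a) of (A, a) \<Rightarrow> (a, A - {a})) = p"
      "(case p of (a, A) \<Rightarrow> (insert a A, a)) \<in> (SIGMA A:{A. A \<subseteq> S \<and> card A = length (C # Cs)}. A)"
      "(case case p of (a, A) \<Rightarrow> (insert a A, a) of (A, a) \<Rightarrow> C a / (\<Prod>b\<in>S - {a}. a - b) * t (S - {a}) (A - {a})) =
       (case p of (a, A) \<Rightarrow> C a / (\<Prod>b\<in>S - {a}. a - b) * t (S - {a}) A)"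
      by auto
  next
    fix p assume "p \<in> (SIGMA A:{A. A \<subseteq> S \<and> card A = length (C # Cs)}. A)"
    then obtain a A where p: "p = (A, a)" "a \<in> A" "A \<subseteq> S" "card A = Suc (length Cs)" by auto
    then show "(case case p of (A, a) \<Rightarrow> (a, A - {a}) of (a, A) \<Rightarrow> (insert a A, a)) = p"
      "(case p of (A, a) \<Rightarrow> (a, A - {a})) \<in> (SIGMA a:S. {A. A \<subseteq> S - {a} \<and> card A = length Cs})"
      by auto
  qed
  also have "\<dots> = (\<Sum>A | A \<subseteq> S \<and> card A = length (C # Cs). \<Sum>a\<in>A.
      C a / (\<Prod>b\<in>S - {a}. a - b) * t (S - {a}) (A - {a}))"
    by (subst sum.Sigma) (use fin Cons.prems in \<open>auto intro: finite_subset[of _ S]\<close>)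
  also have "\<dots> = (\<Sum>A | A \<subseteq> S \<and> card A = length (C # Cs).
      bialternant (C # Cs) A * bialternant Ds (S - A) / (\<Prod>a\<in>A. \<Prod>b\<in>S - A. a - b))"
    unfolding bialternant.simps sum_distrib_right sum_divide_distrib
    by (intro sum.cong refl step) auto
  finally show ?case .
qed

text \<open>
  Expanding along the first two columns reduces the alternating property to sets of two elements.
  Vanishing for equal columns is recorded separately from the sign rule because it does not follow
  from it in characteristic 2.
\<close>
lemma bialternant_pair_swap: "bialternant [C, D] A = - bialternant [D, C] A" and
  bialternant_pair_same: "bialternant [C, C] A = 0" if "card A = 2"
proof -
  obtain a b where A: "A = {a, b}" "a \<noteq> b" using \<open>card A = 2\<close> by (auto simp: card_2_iff)
  have "{a, b} - {a} = {b}" "{a, b} - {b} = {a}" using A by auto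
  then show "bialternant [C, D] A = - bialternant [D, C] A" "bialternant [C, C] A = 0"
    using A by (simp_all add: divide_simps) (simp_all add: algebra_simps)
qed

lemma bialternant_swap_head:
  assumes "finite S"
  shows "bialternant (C # D # Ds) S = - bialternant (D # C # Ds) S"
proof -
  have "bialternant ([C, D] @ Ds) S = - bialternant ([D, C] @ Ds) S"
    unfolding bialternant_append[OF assms] sum_negf[symmetric]
    by (rule sum.cong) (simp_all add: bialternant_pair_swap[of _ C D] del: bialternant.simps)
  then show ?thesis by (simp del: bialternant.simps)
qed

lemma bialternant_same_head:
  assumes "finite S"
  shows "bialternant (C # C # Ds) S = 0"
proof -
  have "bialternant ([C, C] @ Ds) S = 0"
    unfolding bialternant_append[OF assms]
    by (rule sum.neutral) (simp add: bialternant_pair_same del: bialternant.simps)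
  then show ?thesis by (simp del: bialternant.simps)
qed

lemma bialternant_append_cong:
  assumes "\<And>T. finite T \<Longrightarrow> bialternant Cs T = c * bialternant Ds T" "finite S"
  shows "bialternant (Ps @ Cs) S = c * bialternant (Ps @ Ds) S"
  using assms(2) by (induction Ps arbitrary: S) (auto simp: assms(1) sum_distrib_left mult_ac)

lemma bialternant_linear:
  "bialternant (Ps @ (\<lambda>a. c * C a - d * D a) # Qs) S =
     c * bialternant (Ps @ C # Qs) S - d * bialternant (Ps @ D # Qs) S"
  by (induction Ps arbitrary: S)
    (simp_all add: sum_distrib_left sum_subtractf[symmetric] diff_divide_distrib left_diff_distrib
      right_diff_distrib mult_ac)

lemma bialternant_sum:
  "bialternant (Ps @ (\<lambda>a. \<Sum>m\<in>M. w m * C m a) # Qs) S = (\<Sum>m\<in>M. w m * bialternant (Ps @ C m # Qs) S)"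
proof (induction Ps arbitrary: S)
  case Nil
  show ?case
    by (simp add: sum_distrib_left sum_distrib_right sum_divide_distrib mult.assoc sum.swap[of _ S])
next
  case (Cons P Ps)
  show ?case
    by (simp add: Cons sum_distrib_left sum.swap[of _ S] mult_ac)
qed

text \<open>
  Moving the second copy of \<open>C\<close> one place to the left changes only the sign, until the two copies
  are adjacent.
\<close>
lemma bialternant_repeated:
  "finite S \<Longrightarrow> C \<in> set Ds \<Longrightarrow> bialternant (C # Ds) S = 0"
proof (induction Ds arbitrary: S)
  case (Cons D Ds)
  show ?case
  proof (cases "C = D")
    case False
    then have "bialternant (C # Ds) (S - {a}) = 0" for a
      using Cons by auto
    then have "bialternant (D # C # Ds) S = 0" by (simp del: bialternant.simps add: bialternant.simps(2)[of D])
    then show ?thesis using bialternant_swap_head[OF Cons.prems(1), of C D Ds] by (simp del: bialternant.simps)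
  next
    case True
    then show ?thesis using bialternant_same_head[OF Cons.prems(1), of D Ds] by (simp del: bialternant.simps)
  qed
qed simp

lemma bialternant_factor:
  "finite S \<Longrightarrow> card S = length Cs \<Longrightarrow>
   bialternant (map (\<lambda>C a. h a * C a) Cs) S = (\<Prod>a\<in>S. h a) * bialternant Cs S"
proof (induction Cs arbitrary: S)
  case (Cons C Cs)
  have "bialternant (map (\<lambda>C a. h a * C a) Cs) (S - {a}) = (\<Prod>a\<in>S - {a}. h a) * bialternant Cs (S - {a})"
    if "a \<in> S" for a
    using Cons.IH[of "S - {a}"] Cons.prems that by simp
  moreover have "(\<Prod>a\<in>S. h a) = h a * (\<Prod>a\<in>S - {a}. h a)" if "a \<in> S" for a
    using Cons.prems(1) that by (rule prod.remove)
  ultimately have "h a * C a / (\<Prod>b\<in>S - {a}. a - b) * bialternant (map (\<lambda>C a. h a * C a) Cs) (S - {a}) =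
      (\<Prod>a\<in>S. h a) * (C a / (\<Prod>b\<in>S - {a}. a - b) * bialternant Cs (S - {a}))" if "a \<in> S" for a
    using that by simp
  then show ?case by (auto simp: sum_distrib_left intro!: sum.cong simp del: times_divide_eq_right times_divide_eq_left)
qed simp

text \<open>
  Expansion of the determinant along the row of \<open>z\<close>. The product on the left is the part of the
  Vandermonde product that involves \<open>z\<close>, with \<open>z\<close> placed last.
\<close>
lemma bialternant_insert:
  assumes "finite Y" "z \<notin> Y" "length Cs = Suc (card Y)"
  shows "bialternant Cs (insert z Y) * (\<Prod>b\<in>Y. b - z) =
    (\<Sum>p<length Cs. (- 1) ^ (length Cs - Suc p) * (Cs ! p) z *
       bialternant (take p Cs @ drop (Suc p) Cs) Y)"
  using assms
proof (induction Cs arbitrary: Y)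
  case (Cons C Cs)
  let ?P = "\<Prod>b\<in>Y. b - z"
  have P0: "?P \<noteq> 0" using Cons.prems by auto
  have flip: "(\<Prod>b\<in>Y. z - b) = (- 1) ^ length Cs * ?P"
    using Cons.prems by (simp flip: prod_constant prod.distrib)
  have first: "C z / (\<Prod>b\<in>Y. z - b) * bialternant Cs Y * ?P = (- 1) ^ length Cs * C z * bialternant Cs Y"
    unfolding flip using P0 by (simp add: field_simps flip: power_add mult_2)
  have rest: "C a / (\<Prod>b\<in>insert z Y - {a}. a - b) * bialternant Cs (insert z Y - {a}) * ?P =
      (\<Sum>p<length Cs. (- 1) ^ (length Cs - Suc p) * (Cs ! p) z *
         (C a / (\<Prod>b\<in>Y - {a}. a - b) * bialternant (take p Cs @ drop (Suc p) Cs) (Y - {a})))"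
    if a: "a \<in> Y" for a
  proof -
    have az: "a - z \<noteq> 0" and ins: "insert z Y - {a} = insert z (Y - {a})"
      using a Cons.prems by auto
    have "length Cs = Suc (card (Y - {a}))"
      using Cons.prems a by (metis card_Suc_Diff1 length_Cons nat.inject)
    from Cons.IH[OF _ _ this] have IH: "bialternant Cs (insert z (Y - {a})) * (\<Prod>b\<in>Y - {a}. b - z) =
      (\<Sum>p<length Cs. (- 1) ^ (length Cs - Suc p) * (Cs ! p) z *
        bialternant (take p Cs @ drop (Suc p) Cs) (Y - {a}))"
      using Cons.prems by auto
    have "(\<Prod>b\<in>insert z (Y - {a}). a - b) = (a - z) * (\<Prod>b\<in>Y - {a}. a - b)"
      "?P = (a - z) * (\<Prod>b\<in>Y - {a}. b - z)"
      using Cons.prems a by (simp_all add: prod.remove)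
    then have "C a / (\<Prod>b\<in>insert z Y - {a}. a - b) * bialternant Cs (insert z Y - {a}) * ?P =
      C a / (\<Prod>b\<in>Y - {a}. a - b) * (bialternant Cs (insert z (Y - {a})) * (\<Prod>b\<in>Y - {a}. b - z))"
      using az by (simp add: ins)
    then show ?thesis unfolding IH by (simp add: sum_distrib_left mult_ac)
  qed
  have restsum:
    "(\<Sum>a\<in>Y. C a / (\<Prod>b\<in>insert z Y - {a}. a - b) * bialternant Cs (insert z Y - {a}) * ?P) =
     (\<Sum>a\<in>Y. \<Sum>p<length Cs. (- 1) ^ (length Cs - Suc p) * (Cs ! p) z *
         (C a / (\<Prod>b\<in>Y - {a}. a - b) * bialternant (take p Cs @ drop (Suc p) Cs) (Y - {a})))"
    by (rule sum.cong[OF refl rest])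
  have "bialternant (C # Cs) (insert z Y) * ?P =
    C z / (\<Prod>b\<in>Y. z - b) * bialternant Cs Y * ?P +
    (\<Sum>a\<in>Y. C a / (\<Prod>b\<in>insert z Y - {a}. a - b) * bialternant Cs (insert z Y - {a}) * ?P)"
    using Cons.prems by (simp add: algebra_simps sum_distrib_left)
  also have "\<dots> = (\<Sum>p<length (C # Cs). (- 1) ^ (length (C # Cs) - Suc p) * ((C # Cs) ! p) z *
       bialternant (take p (C # Cs) @ drop (Suc p) (C # Cs)) Y)"
    unfolding first restsum sum.swap[of _ "{..<length Cs}"]
    by (simp add: sum.lessThan_Suc_shift sum_distrib_left del: sum.lessThan_Suc)
  finally show ?case .
qed simp

section \<open>Bidiagonal column operations\<close>

text \<open>
  Columns \<open>t C\<^sub>j - F\<^sub>j C\<^sub>j\<^sub>+\<^sub>1\<close>, one fewer than the original columns. The branching rule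
  produces them, and the next two lemmas compute their bialternant.
\<close>
fun bidiag :: "'a::field \<Rightarrow> 'a list \<Rightarrow> ('a \<Rightarrow> 'a) list \<Rightarrow> ('a \<Rightarrow> 'a) list" where
  "bidiag t (F # Fs) (C # D # Cs) = (\<lambda>a. t * C a - F * D a) # bidiag t Fs (D # Cs)"
| "bidiag t _ _ = []"

text \<open>
  Once \<open>C\<^sub>1\<close> is present, only \<open>- F\<^sub>1 C\<^sub>2\<close> survives from the next column, then only
  \<open>- F\<^sub>2 C\<^sub>3\<close>, and so on: the other terms repeat a column.
\<close>
lemma bialternant_bidiag_absorb:
  "finite S \<Longrightarrow> length Fs = length Cs \<Longrightarrow>
   bialternant (Ps @ C # bidiag t Fs (C # Cs)) S = (- 1) ^ length Fs * prod_list Fs * bialternant (Ps @ C # Cs) S"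
proof (induction Fs arbitrary: Cs C Ps)
  case (Cons F Fs)
  then obtain D Ds where Cs: "Cs = D # Ds" "length Fs = length Ds" by (cases Cs) auto
  have "bialternant (Ps @ C # C # Q) S = 0" for Q
    using bialternant_append_cong[of "C # C # Q" 0 "[]" S Ps] Cons.prems by (simp add: bialternant_same_head del: bialternant.simps)
  then have "bialternant (Ps @ C # bidiag t (F # Fs) (C # Cs)) S =
      - F * bialternant ((Ps @ [C]) @ D # bidiag t Fs (D # Ds)) S"
    using bialternant_linear[of "Ps @ [C]" t C F D] by (simp add: Cs)
  then show ?case using Cons.IH[of Ds "Ps @ [C]" D] Cons.prems Cs by simp
qed simp

text \<open>
  Multilinear expansion. A choice of \<open>t C\<^sub>j\<close> or \<open>- F\<^sub>j C\<^sub>j\<^sub>+\<^sub>1\<close> in every column repeats a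
  column unless the first option is taken up to some position and the second one from there on, so
  exactly one of the original columns is missing. Reading the formula from right to left replaces
  a row expansion by a single bialternant without dividing by \<open>t\<close>, which may be \<open>0\<close>.
\<close>
lemma bialternant_bidiag:
  "finite S \<Longrightarrow> length Cs = Suc (length Fs) \<Longrightarrow>
   bialternant (Ps @ bidiag t Fs Cs) S =
   (\<Sum>p<length Cs. (- 1) ^ (length Cs - Suc p) * (t ^ p * prod_list (drop p Fs)) *
      bialternant (Ps @ take p Cs @ drop (Suc p) Cs) S)"
proof (induction Fs arbitrary: Cs Ps)
  case Nil
  then show ?case by (auto simp: length_Suc_conv)
next
  case (Cons F Fs)
  then obtain C D Ds where Cs: "Cs = C # D # Ds" "length Ds = length Fs"
    by (auto simp: length_Suc_conv)
  have "bialternant (Ps @ bidiag t (F # Fs) Cs) S =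
      t * bialternant ((Ps @ [C]) @ bidiag t Fs (D # Ds)) S - F * bialternant (Ps @ D # bidiag t Fs (D # Ds)) S"
    by (simp add: Cs bialternant_linear)
  also have "F * bialternant (Ps @ D # bidiag t Fs (D # Ds)) S =
      (- 1) ^ length Fs * (F * prod_list Fs) * bialternant (Ps @ D # Ds) S"
    using Cons.prems Cs by (simp add: bialternant_bidiag_absorb)
  also have "bialternant ((Ps @ [C]) @ bidiag t Fs (D # Ds)) S =
    (\<Sum>p<length (D # Ds). (- 1) ^ (length (D # Ds) - Suc p) * (t ^ p * prod_list (drop p Fs)) *
      bialternant ((Ps @ [C]) @ take p (D # Ds) @ drop (Suc p) (D # Ds)) S)"
    using Cons.prems Cs by (intro Cons.IH) simp_all
  also have "t * \<dots> - (- 1) ^ length Fs * (F * prod_list Fs) * bialternant (Ps @ D # Ds) S =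
    (\<Sum>p<length Cs. (- 1) ^ (length Cs - Suc p) * (t ^ p * prod_list (drop p (F # Fs))) *
      bialternant (Ps @ take p Cs @ drop (Suc p) Cs) S)"
    unfolding Cs sum_distrib_left
    by (simp add: sum.lessThan_Suc_shift Cs(2) mult_ac del: sum.lessThan_Suc)
  finally show ?case .
qed

section \<open>The columns of the determinantal formula\<close>

definition factorial_power :: "'a::field \<Rightarrow> (nat \<Rightarrow> 'a) \<Rightarrow> 'a \<Rightarrow> nat \<Rightarrow> 'a" where
  "factorial_power \<beta> y x m = (\<Prod>i\<in>{1..m}. oplus \<beta> x (y i))"

text \<open>
  The columns \<open>[a|y]\<^sup>e (1 + \<beta> a)\<^sup>j\<close>, where \<open>e\<close> runs through the list and \<open>j\<close> counts up from
  \<open>r\<close>. The start \<open>r\<close> makes a final segment of such a list again one of this form.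
\<close>
primrec columns :: "'a::field \<Rightarrow> (nat \<Rightarrow> 'a) \<Rightarrow> nat \<Rightarrow> nat list \<Rightarrow> ('a \<Rightarrow> 'a) list" where
  "columns \<beta> y r [] = []"
| "columns \<beta> y r (e # es) = (\<lambda>a. factorial_power \<beta> y a e * (1 + \<beta> * a) ^ r) # columns \<beta> y (Suc r) es"

text \<open>
  The strictly decreasing exponents \<open>\<lambda>\<^sub>j + n - j\<close> for \<open>j = 1, \<dots>, n\<close> that a partition with
  \<open>n\<close> parts contributes to its alternant.
\<close>
primrec row_exponents :: "nat list \<Rightarrow> nat list" where
  "row_exponents [] = []"
| "row_exponents (l # ls) = (l + length ls) # row_exponents ls"

section \<open>The branching rule for bialternants\<close>

text \<open>
  The shapes \<open>\<mu>\<close> with one row fewer for which \<open>\<lambda>/\<mu>\<close> is a horizontal strip: exactly the shapes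
  that the entries below the largest one can occupy in a set-valued tableau of shape \<open>\<lambda>\<close> whose
  entries are bounded by the number of rows of \<open>\<lambda>\<close>.
\<close>
definition interlacing :: "nat list \<Rightarrow> nat list set" where
  "interlacing lam = {mu. length lam = Suc (length mu) \<and>
     (\<forall>i<length mu. lam ! Suc i \<le> mu ! i \<and> mu ! i \<le> lam ! i)}"

text \<open>
  The contribution of the largest entry to one row whose length is \<open>l\<close>, with \<open>l'\<close> squares in the
  row below, when the smaller entries fill the first \<open>m\<close> squares; \<open>L\<close> is the number of rows below.
  The squares beyond \<open>m\<close> contain the largest entry only. Square \<open>m\<close> may contain it in addition,
  which brings in a further factor \<open>\<beta>\<close>, unless there is a square below it.
\<close>
definition row_weight :: "'a::field \<Rightarrow> (nat \<Rightarrow> 'a) \<Rightarrow> 'a \<Rightarrow> nat \<Rightarrow> nat \<Rightarrow> nat \<Rightarrow> nat \<Rightarrow> 'a" where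
  "row_weight \<beta> y z L l l' m =
     (\<Prod>c\<in>{m<..l}. oplus \<beta> z (y (c + L))) * (if l' < m then 1 + \<beta> * oplus \<beta> z (y (m + L)) else 1)"

definition branch_weight :: "'a::field \<Rightarrow> (nat \<Rightarrow> 'a) \<Rightarrow> 'a \<Rightarrow> nat list \<Rightarrow> nat list \<Rightarrow> 'a" where
  "branch_weight \<beta> y z lam mu =
     (\<Prod>i<length mu. row_weight \<beta> y z (length lam - Suc i) (lam ! i) (lam ! Suc i) (mu ! i))"

lemma factorial_power_0 [simp]: "factorial_power \<beta> y x 0 = 1"
  and factorial_power_Suc: "factorial_power \<beta> y x (Suc m) = factorial_power \<beta> y x m * oplus \<beta> x (y (Suc m))"
  by (simp_all add: factorial_power_def)

lemma length_columns [simp]: "length (columns \<beta> y r es) = length es"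
  by (induction es arbitrary: r) simp_all

lemma length_row_exponents [simp]: "length (row_exponents lam) = length lam"
  by (induction lam) simp_all

lemma columns_append: "columns \<beta> y r (es @ es') = columns \<beta> y r es @ columns \<beta> y (r + length es) es'"
  by (induction es arbitrary: r) simp_all

text \<open>
  The sum telescopes: with \<open>e = m + N + 1\<close> we have
  \<open>(x \<oplus> y\<^sub>e) - (z \<oplus> y\<^sub>e) = (x - z) (1 + \<beta> y\<^sub>e)\<close> and
  \<open>1 + \<beta> (z \<oplus> y\<^sub>e) = (1 + \<beta> z) (1 + \<beta> y\<^sub>e)\<close>, so a summand with \<open>m > l'\<close> times \<open>x - z\<close>
  is \<open>1 + \<beta> z\<close> times a difference of consecutive terms. The summand \<open>m = l'\<close> lacks this factor,
  and the correction turns \<open>1 + \<beta> z\<close> into \<open>1 + \<beta> x\<close> in the lower boundary term. Through this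
  \<open>1 + \<beta> x\<close> the boundary term becomes a multiple of the next column.
\<close>
lemma factorial_power_telescope:
  assumes "l' \<le> l"
  shows "(x - z) * (\<Sum>m\<in>{l'..l}. row_weight \<beta> y z (Suc N) l l' m * factorial_power \<beta> y x (m + N)) =
    (1 + \<beta> * z) * factorial_power \<beta> y x (l + Suc N) -
    (1 + \<beta> * x) * factorial_power \<beta> y x (l' + N) * (\<Prod>c\<in>{l' + N<..l + Suc N}. oplus \<beta> z (y c))"
  using assms
proof (induction l rule: dec_induct)
  case base
  have "{l' + N<..Suc (l' + N)} = {Suc (l' + N)}" by auto
  then show ?case
    by (simp add: row_weight_def factorial_power_Suc) (simp add: oplus_def algebra_simps)
next
  case (step l)
  define Y where "Y = y (Suc (Suc (l + N)))"
  define Q where "Q = (\<Prod>c\<in>{l' + N<..l + Suc N}. oplus \<beta> z (y c))"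
  define f where "f = factorial_power \<beta> y x (l + Suc N)"
  have w: "row_weight \<beta> y z (Suc N) (Suc l) l' m = oplus \<beta> z Y * row_weight \<beta> y z (Suc N) l l' m"
    if "m \<le> l" for m
  proof -
    have "{m<..Suc l} = insert (Suc l) {m<..l}" using that by auto
    then show ?thesis by (simp add: row_weight_def Y_def)
  qed
  have new: "row_weight \<beta> y z (Suc N) (Suc l) l' (Suc l) = 1 + \<beta> * oplus \<beta> z Y"
    using step.hyps by (simp add: row_weight_def Y_def)
  have "{l' + N<..Suc l + Suc N} = insert (Suc (Suc (l + N))) {l' + N<..l + Suc N}"
    using step.hyps by auto
  then have Q: "(\<Prod>c\<in>{l' + N<..Suc l + Suc N}. oplus \<beta> z (y c)) = oplus \<beta> z Y * Q"
    by (simp add: Q_def Y_def)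
  have f: "factorial_power \<beta> y x (Suc l + Suc N) = f * oplus \<beta> x Y" "factorial_power \<beta> y x (Suc (N + l)) = f"
    by (simp_all add: f_def Y_def factorial_power_Suc add.commute)
  have "(x - z) * (\<Sum>m\<in>{l'..Suc l}. row_weight \<beta> y z (Suc N) (Suc l) l' m * factorial_power \<beta> y x (m + N)) =
     oplus \<beta> z Y * ((x - z) * (\<Sum>m\<in>{l'..l}. row_weight \<beta> y z (Suc N) l l' m * factorial_power \<beta> y x (m + N)))
     + (x - z) * ((1 + \<beta> * oplus \<beta> z Y) * f)"
    using step.hyps by (simp add: w new f(2) sum_distrib_left algebra_simps)
  also have "\<dots> = (1 + \<beta> * z) * (f * oplus \<beta> x Y) -
      (1 + \<beta> * x) * factorial_power \<beta> y x (l' + N) * (oplus \<beta> z Y * Q)"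
    unfolding step.IH f_def[symmetric] Q_def[symmetric] by (simp add: oplus_def algebra_simps)
  finally show ?case unfolding Q f .
qed

text \<open>
  The factors by which consecutive factorial powers of \<open>z\<close> in the alternant of \<open>\<lambda>\<close> differ.
\<close>
fun gaps :: "'a::field \<Rightarrow> (nat \<Rightarrow> 'a) \<Rightarrow> 'a \<Rightarrow> nat list \<Rightarrow> 'a list" where
  "gaps \<beta> y z (l # l' # ls) =
     (\<Prod>c\<in>{l' + length ls<..l + Suc (length ls)}. oplus \<beta> z (y c)) # gaps \<beta> y z (l' # ls)"
| "gaps \<beta> y z _ = []"

text \<open>
  Each column collects, for one row of \<open>\<lambda>\<close>, the weighted columns of all lengths which that row may
  have in an interlacing shape.
\<close>
fun branch_columns :: "'a::field \<Rightarrow> (nat \<Rightarrow> 'a) \<Rightarrow> 'a \<Rightarrow> nat \<Rightarrow> nat list \<Rightarrow> ('a \<Rightarrow> 'a) list" where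
  "branch_columns \<beta> y z r (l # l' # ls) =
     (\<lambda>a. \<Sum>m\<in>{l'..l}. row_weight \<beta> y z (Suc (length ls)) l l' m *
        (factorial_power \<beta> y a (m + length ls) * (1 + \<beta> * a) ^ r)) # branch_columns \<beta> y z (Suc r) (l' # ls)"
| "branch_columns \<beta> y z r _ = []"

lemma length_gaps: "length (gaps \<beta> y z lam) = length lam - 1"
  by (induction lam rule: induct_list012) simp_all

lemma length_branch_columns: "length (branch_columns \<beta> y z r lam) = length lam - 1"
  by (induction lam arbitrary: r rule: induct_list012) simp_all

lemma branch_columns_bidiag:
  "is_partition lam \<Longrightarrow> map (\<lambda>C a. (a - z) * C a) (branch_columns \<beta> y z r lam) =
     bidiag (1 + \<beta> * z) (gaps \<beta> y z lam) (columns \<beta> y r (row_exponents lam))"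
proof (induction lam arbitrary: r rule: induct_list012)
  case (3 l l' ls)
  have le: "l' \<le> l" and part: "is_partition (l' # ls)"
    using "3.prems" by (auto simp: is_partition_def)
  have "(a - z) * (\<Sum>m\<in>{l'..l}. row_weight \<beta> y z (Suc (length ls)) l l' m *
      (factorial_power \<beta> y a (m + length ls) * (1 + \<beta> * a) ^ r)) =
      ((a - z) * (\<Sum>m\<in>{l'..l}. row_weight \<beta> y z (Suc (length ls)) l l' m *
        factorial_power \<beta> y a (m + length ls))) * (1 + \<beta> * a) ^ r" for a
    by (simp add: sum_distrib_left sum_distrib_right mult_ac)
  also have "\<dots> a = (1 + \<beta> * z) * (factorial_power \<beta> y a (l + Suc (length ls)) * (1 + \<beta> * a) ^ r) -
      (\<Prod>c\<in>{l' + length ls<..l + Suc (length ls)}. oplus \<beta> z (y c)) *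
      (factorial_power \<beta> y a (l' + length ls) * (1 + \<beta> * a) ^ Suc r)" for a
    unfolding factorial_power_telescope[OF le] by (simp add: algebra_simps)
  finally show ?case
    using "3.IH"(2)[OF part, of "Suc r"] by simp
qed simp_all

text \<open>
  In the row of \<open>z\<close> the entries are, up to a common factor, the coefficients that
  \<open>bialternant_bidiag\<close> attaches to the missing columns.
\<close>
lemma columns_at_z:
  "is_partition lam \<Longrightarrow> p < length lam \<Longrightarrow> (columns \<beta> y r (row_exponents lam) ! p) z =
     (1 + \<beta> * z) ^ (r + p) * prod_list (drop p (gaps \<beta> y z lam)) * factorial_power \<beta> y z (last lam)"
proof (induction lam arbitrary: r p rule: induct_list012)
  case (3 l l' ls)
  have le: "l' \<le> l" and part: "is_partition (l' # ls)"
    using "3.prems" by (auto simp: is_partition_def)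
  show ?case
  proof (cases p)
    case 0
    have "{1..l + Suc (length ls)} = {1..l' + length ls} \<union> {l' + length ls<..l + Suc (length ls)}"
      using le by auto
    then have "factorial_power \<beta> y z (l + Suc (length ls)) = factorial_power \<beta> y z (l' + length ls) *
        (\<Prod>c\<in>{l' + length ls<..l + Suc (length ls)}. oplus \<beta> z (y c))"
      unfolding factorial_power_def by (simp only:) (rule prod.union_disjoint, auto)
    moreover have "factorial_power \<beta> y z (l' + length ls) = prod_list (gaps \<beta> y z (l' # ls)) * factorial_power \<beta> y z (last (l' # ls))"
      using "3.IH"(2)[of 0 0] part by simp
    ultimately show ?thesis using 0 by (simp add: mult_ac)
  next
    case (Suc q)
    then show ?thesis using "3.IH"(2)[of q "Suc r"] "3.prems" part by simp
  qed
qed simp_all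

lemma interlacing_Cons:
  "interlacing (l # l' # ls) = (\<lambda>(m, ms). m # ms) ` ({l'..l} \<times> interlacing (l' # ls))"
proof (intro set_eqI iffI)
  fix mu assume mu: "mu \<in> interlacing (l # l' # ls)"
  then obtain m ms where "mu = m # ms" by (cases mu) (auto simp: interlacing_def)
  with mu show "mu \<in> (\<lambda>(m, ms). m # ms) ` ({l'..l} \<times> interlacing (l' # ls))"
    by (force simp: interlacing_def image_iff)
next
  fix mu assume "mu \<in> (\<lambda>(m, ms). m # ms) ` ({l'..l} \<times> interlacing (l' # ls))"
  then show "mu \<in> interlacing (l # l' # ls)"
    by (auto simp: interlacing_def less_Suc_eq_0_disj)
qed

lemma interlacing_single: "interlacing [l] = {[]}"
  by (auto simp: interlacing_def)

lemma finite_interlacing [simp]: "finite (interlacing lam)"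
proof (induction lam rule: induct_list012)
  case 1
  then show ?case by (simp add: interlacing_def)
qed (simp_all add: interlacing_single interlacing_Cons)

lemma branch_weight_Cons:
  "branch_weight \<beta> y z (l # l' # ls) (m # ms) =
     row_weight \<beta> y z (Suc (length ls)) l l' m * branch_weight \<beta> y z (l' # ls) ms"
  by (simp add: branch_weight_def prod.lessThan_Suc_shift del: prod.lessThan_Suc)

text \<open>
  The rows of an interlacing shape vary independently of each other, so the sum over all of them
  factors column by column.
\<close>
lemma bialternant_branch_columns:
  "lam \<noteq> [] \<Longrightarrow> bialternant (Ps @ branch_columns \<beta> y z r lam) S =
     (\<Sum>mu\<in>interlacing lam. branch_weight \<beta> y z lam mu * bialternant (Ps @ columns \<beta> y r (row_exponents mu)) S)"
proof (induction lam arbitrary: Ps r rule: induct_list012)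
  case (2 l)
  then show ?case by (simp add: interlacing_single branch_weight_def)
next
  case (3 l l' ls)
  define C where "C m = (\<lambda>a. factorial_power \<beta> y a (m + length ls) * (1 + \<beta> * a) ^ r)" for m
  have inj: "inj_on (\<lambda>(m, ms). m # ms) X" for X :: "(nat \<times> nat list) set" by (auto simp: inj_on_def)
  have "bialternant (Ps @ branch_columns \<beta> y z r (l # l' # ls)) S =
      (\<Sum>m\<in>{l'..l}. row_weight \<beta> y z (Suc (length ls)) l l' m *
        bialternant ((Ps @ [C m]) @ branch_columns \<beta> y z (Suc r) (l' # ls)) S)"
    using bialternant_sum[of Ps _ C] by (simp add: C_def)
  also have "\<dots> = (\<Sum>m\<in>{l'..l}. \<Sum>ms\<in>interlacing (l' # ls).
      row_weight \<beta> y z (Suc (length ls)) l l' m * (branch_weight \<beta> y z (l' # ls) ms *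
        bialternant ((Ps @ [C m]) @ columns \<beta> y (Suc r) (row_exponents ms)) S))"
    by (subst "3.IH"(2)) (simp_all add: sum_distrib_left)
  also have "\<dots> = (\<Sum>m\<in>{l'..l}. \<Sum>ms\<in>interlacing (l' # ls).
      branch_weight \<beta> y z (l # l' # ls) (m # ms) * bialternant (Ps @ columns \<beta> y r (row_exponents (m # ms))) S)"
    by (intro sum.cong refl) (auto simp: branch_weight_Cons C_def interlacing_def)
  also have "\<dots> = (\<Sum>mu\<in>interlacing (l # l' # ls). branch_weight \<beta> y z (l # l' # ls) mu *
      bialternant (Ps @ columns \<beta> y r (row_exponents mu)) S)"
    unfolding interlacing_Cons sum.reindex[OF inj] sum.cartesian_product
    by (rule sum.cong) auto
  finally show ?case .
qed simp

text \<open>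
  Up to a factorial power of \<open>z\<close>, the expansion along the row of \<open>z\<close> is the bialternant of the
  bidiagonal columns; these are
  \<open>a - z\<close> times the branch columns, and the factors \<open>a - z\<close> cancel the part of the Vandermonde
  product that involves \<open>z\<close>.
\<close>
theorem bialternant_branching:
  assumes "is_partition lam" "length lam = Suc (card Y)" "finite Y" "z \<notin> Y"
  shows "bialternant (columns \<beta> y 0 (row_exponents lam)) (insert z Y) =
    (\<Sum>mu\<in>interlacing lam. factorial_power \<beta> y z (last lam) * branch_weight \<beta> y z lam mu *
       bialternant (columns \<beta> y 0 (row_exponents mu)) Y)"
proof -
  let ?Cs = "columns \<beta> y 0 (row_exponents lam)" and ?Fs = "gaps \<beta> y z lam"
  let ?Bs = "branch_columns \<beta> y z 0 lam" and ?P = "\<Prod>b\<in>Y. b - z"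
  have "?P \<noteq> 0" using assms by auto
  have "bialternant ?Cs (insert z Y) * ?P = (\<Sum>p<length ?Cs. (- 1) ^ (length ?Cs - Suc p) * (?Cs ! p) z *
       bialternant (take p ?Cs @ drop (Suc p) ?Cs) Y)"
    using assms by (intro bialternant_insert) simp_all
  also have "\<dots> = factorial_power \<beta> y z (last lam) * (\<Sum>p<length ?Cs. (- 1) ^ (length ?Cs - Suc p) *
       ((1 + \<beta> * z) ^ p * prod_list (drop p ?Fs)) * bialternant ([] @ take p ?Cs @ drop (Suc p) ?Cs) Y)"
    unfolding sum_distrib_left
    by (intro sum.cong refl) (simp add: columns_at_z[OF assms(1)] mult_ac)
  also have "\<dots> = factorial_power \<beta> y z (last lam) * bialternant ([] @ bidiag (1 + \<beta> * z) ?Fs ?Cs) Y"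
    using assms by (subst bialternant_bidiag) (simp_all add: length_gaps)
  also have "\<dots> = factorial_power \<beta> y z (last lam) * bialternant (map (\<lambda>C a. (a - z) * C a) ?Bs) Y"
    using assms by (simp add: branch_columns_bidiag)
  also have "\<dots> = factorial_power \<beta> y z (last lam) * bialternant ([] @ ?Bs) Y * ?P"
    using assms by (simp add: bialternant_factor length_branch_columns)
  finally have "bialternant ?Cs (insert z Y) = factorial_power \<beta> y z (last lam) * bialternant ([] @ ?Bs) Y"
    using \<open>?P \<noteq> 0\<close> by simp
  also have "lam \<noteq> []" using assms by auto
  note bialternant_branch_columns[OF this]
  finally show ?thesis by (simp add: sum_distrib_left mult_ac)
qed

section \<open>Set-valued tableaux as functions with prescribed support\<close>

lemma mem_diagram: "(i, j) \<in> diagram lam \<longleftrightarrow> 1 \<le> i \<and> i \<le> length lam \<and> 1 \<le> j \<and> j \<le> lam ! (i - 1)"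
  by (simp add: diagram_def)

lemma partition_nth_mono:
  "is_partition lam \<Longrightarrow> i \<le> j \<Longrightarrow> j < length lam \<Longrightarrow> lam ! j \<le> lam ! i"
  unfolding is_partition_def by (cases "i = j") (auto simp: sorted_wrt_iff_nth_less)

lemma svt_support:
  assumes "T \<in> svt lam n"
  shows "T \<alpha> \<noteq> {} \<longleftrightarrow> \<alpha> \<in> diagram lam"
proof -
  have "set_valued_tableau lam T" using assms by (simp add: svt_def)
  note tab = this[unfolded set_valued_tableau_def]
  show ?thesis using tab[THEN conjunct1] tab[THEN conjunct2, THEN conjunct1] by blast
qed

lemma svt_subset:
  assumes "T \<in> svt lam n"
  shows "T \<alpha> \<subseteq> {1..n}"
proof (cases "\<alpha> \<in> diagram lam")
  case True
  then show ?thesis using assms by (simp add: svt_def)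
next
  case False
  then show ?thesis using svt_support[OF assms, of \<alpha>] by simp
qed

lemma svt_finite: "T \<in> svt lam n \<Longrightarrow> finite (T \<alpha>)"
  using finite_subset[OF svt_subset] by blast

lemma svt_row:
  assumes T: "T \<in> svt lam n" and "j < j'" "s \<in> T (i, j)" "t \<in> T (i, j')"
  shows "s \<le> t"
proof -
  have "set_valued_tableau lam T" using T by (simp add: svt_def)
  note tab = this[unfolded set_valued_tableau_def]
  have "(i, j) \<in> diagram lam" "(i, j') \<in> diagram lam"
    using assms svt_support[OF T] by blast+
  then have "Max (T (i, j)) \<le> Min (T (i, j'))"
    using tab[THEN conjunct2, THEN conjunct2, THEN conjunct1] assms(2) by simp
  then show ?thesis
    using Max_ge[OF svt_finite[OF T] assms(3)] Min_le[OF svt_finite[OF T] assms(4)] by linarith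
qed

lemma svt_column:
  assumes T: "T \<in> svt lam n" and "i < i'" "s \<in> T (i, j)" "t \<in> T (i', j)"
  shows "s < t"
proof -
  have "set_valued_tableau lam T" using T by (simp add: svt_def)
  note tab = this[unfolded set_valued_tableau_def]
  have "(i, j) \<in> diagram lam" "(i', j) \<in> diagram lam"
    using assms svt_support[OF T] by blast+
  then have "Max (T (i, j)) < Min (T (i', j))"
    using tab[THEN conjunct2, THEN conjunct2, THEN conjunct2] assms(2) by simp
  then show ?thesis
    using Max_ge[OF svt_finite[OF T] assms(3)] Min_le[OF svt_finite[OF T] assms(4)] by linarith
qed

text \<open>
  Membership without reference to maxima and minima. Since a tableau is empty off its diagram, the
  row and column conditions need no restriction to squares of the diagram, and the shape is
  determined by the support.
\<close>
lemma svtI: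
  assumes sub: "\<And>\<alpha>. T \<alpha> \<subseteq> {1..n}" and supp: "\<And>\<alpha>. T \<alpha> \<noteq> {} \<longleftrightarrow> \<alpha> \<in> diagram lam"
    and row: "\<And>i j j' s t. j < j' \<Longrightarrow> s \<in> T (i, j) \<Longrightarrow> t \<in> T (i, j') \<Longrightarrow> s \<le> t"
    and col: "\<And>i i' j s t. i < i' \<Longrightarrow> s \<in> T (i, j) \<Longrightarrow> t \<in> T (i', j) \<Longrightarrow> s < t"
  shows "T \<in> svt lam n"
proof -
  have fin: "finite (T \<alpha>)" for \<alpha> using sub by (rule finite_subset) simp
  have Max: "Max (T \<alpha>) \<in> T \<alpha>" and Min: "Min (T \<alpha>) \<in> T \<alpha>" if "\<alpha> \<in> diagram lam" for \<alpha>
    using that supp[of \<alpha>] fin[of \<alpha>] by simp_all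
  have pos: "0 < t" if "t \<in> T \<alpha>" for \<alpha> t using sub[of \<alpha>] that by force
  have empty: "T \<alpha> = {}" if "\<alpha> \<notin> diagram lam" for \<alpha> using supp[of \<alpha>] that by blast
  have nonempty: "T \<alpha> \<noteq> {}" if "\<alpha> \<in> diagram lam" for \<alpha> using supp[of \<alpha>] that by blast
  have rows: "Max (T (i, j)) \<le> Min (T (i, j'))"
    if "(i, j) \<in> diagram lam" "(i, j') \<in> diagram lam" "j < j'" for i j j'
    using row[OF that(3) Max[OF that(1)] Min[OF that(2)]] .
  have cols: "Max (T (i, j)) < Min (T (i', j))"
    if "(i, j) \<in> diagram lam" "(i', j) \<in> diagram lam" "i < i'" for i i' j
    using col[OF that(3) Max[OF that(1)] Min[OF that(2)]] .
  show ?thesis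
    unfolding svt_def set_valued_tableau_def
    by (intro CollectI conjI ballI allI impI fin sub nonempty empty rows cols; (erule pos)?)
qed

definition entry_weight ::
    "'a::field \<Rightarrow> (nat \<Rightarrow> 'a) \<Rightarrow> (nat \<Rightarrow> 'a) \<Rightarrow> nat \<times> nat \<Rightarrow> nat \<Rightarrow> 'a" where
  "entry_weight \<beta> x y \<alpha> t = oplus \<beta> (x t) (y (nat (int t + content \<alpha>)))"

definition cell_weight ::
    "'a::field \<Rightarrow> (nat \<Rightarrow> 'a) \<Rightarrow> (nat \<Rightarrow> 'a) \<Rightarrow> nat \<times> nat \<Rightarrow> nat set \<Rightarrow> 'a" where
  "cell_weight \<beta> x y \<alpha> A = \<beta> ^ (card A - 1) * (\<Prod>t\<in>A. entry_weight \<beta> x y \<alpha> t)"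

lemma card_diagram: "card (diagram lam) = sum_list lam"
proof -
  have "diagram lam = (\<lambda>(i, j). (Suc i, j)) ` (SIGMA i:{0..<length lam}. {1..lam ! i})"
    by (force simp: diagram_def image_iff Bex_def gr0_conv_Suc Suc_le_eq)
  then show ?thesis
    by (simp add: card_image inj_on_def sum_list_sum_nth)
qed

text \<open>
  No set is empty, so the power of \<open>\<beta>\<close> can be distributed over the squares.
\<close>
lemma grothendieck_cell_weights:
  "grothendieck \<beta> n lam x y = (\<Sum>T\<in>svt lam n. \<Prod>\<alpha>\<in>diagram lam. cell_weight \<beta> x y \<alpha> (T \<alpha>))"
  unfolding grothendieck_def
proof (rule sum.cong[OF refl])
  fix T assume T: "T \<in> svt lam n"
  have "1 \<le> card (T \<alpha>)" if "\<alpha> \<in> diagram lam" for \<alpha>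
    using svt_support[OF T, of \<alpha>] svt_finite[OF T, of \<alpha>] that by (simp add: Suc_le_eq card_gt_0_iff)
  then have "tableau_size lam T - sum_list lam = (\<Sum>\<alpha>\<in>diagram lam. card (T \<alpha>) - 1)"
    unfolding tableau_size_def card_diagram[symmetric] by (simp add: sum_subtractf_nat)
  then show "\<beta> ^ (tableau_size lam T - sum_list lam) *
      (\<Prod>\<alpha>\<in>diagram lam. \<Prod>t\<in>T \<alpha>. oplus \<beta> (x t) (y (nat (int t + content \<alpha>)))) =
      (\<Prod>\<alpha>\<in>diagram lam. cell_weight \<beta> x y \<alpha> (T \<alpha>))"
    by (simp add: cell_weight_def entry_weight_def prod.distrib power_sum)
qed

section \<open>The branching rule for Grothendieck polynomials\<close>

text \<open>
  The squares at the end of a row of \<open>\<mu>\<close> that have no square of \<open>\<lambda>\<close> below them. These are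
  the squares where the largest entry can accompany smaller ones.
\<close>
definition corners :: "nat list \<Rightarrow> nat list \<Rightarrow> (nat \<times> nat) set" where
  "corners lam mu = (\<lambda>i. (Suc i, mu ! i)) ` {i. i < length mu \<and> lam ! Suc i < mu ! i}"

lemma mem_corners: "(i, j) \<in> corners lam mu \<longleftrightarrow>
    1 \<le> i \<and> i \<le> length mu \<and> j = mu ! (i - 1) \<and> lam ! i < j"
  by (cases i) (auto simp: corners_def)

lemma finite_corners [simp]: "finite (corners lam mu)"
  by (simp add: corners_def)

lemma corners_subset: "corners lam mu \<subseteq> diagram mu"
  by (auto simp: mem_corners mem_diagram)

lemma interlacing_diagram:
  assumes "mu \<in> interlacing lam"
  shows "diagram mu \<subseteq> diagram lam"
proof
  fix \<alpha> assume "\<alpha> \<in> diagram mu"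
  then obtain i j where \<alpha>: "\<alpha> = (Suc i, j)" "i < length mu" "1 \<le> j" "j \<le> mu ! i"
    by (cases \<alpha>; cases "fst \<alpha>") (auto simp: mem_diagram)
  moreover have "mu ! i \<le> lam ! i" "length lam = Suc (length mu)"
    using assms \<alpha>(2) by (auto simp: interlacing_def)
  ultimately show "\<alpha> \<in> diagram lam" by (simp add: mem_diagram)
qed

definition insert_entry ::
    "nat \<Rightarrow> (nat \<times> nat) set \<Rightarrow> (nat \<times> nat \<Rightarrow> nat set) \<Rightarrow> nat \<times> nat \<Rightarrow> nat set" where
  "insert_entry n E T \<alpha> = (if \<alpha> \<in> E then insert n (T \<alpha>) else T \<alpha>)"

text \<open>
  Entries increase strictly down a column, starting with a positive one. Hence with \<open>n\<close> rows the
  last row contains only the entry \<open>n\<close>, and the shape of the smaller entries has one row fewer.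
\<close>
lemma row_le_entry:
  assumes "is_partition lam" "T \<in> svt lam n" "s \<in> T (i, j)"
  shows "i \<le> s"
  using assms(3)
proof (induction i arbitrary: s)
  case (Suc i)
  show ?case
  proof (cases "i = 0")
    case True
    then show ?thesis using svt_subset[OF assms(2)] Suc.prems by force
  next
    case False
    have "(Suc i, j) \<in> diagram lam" using Suc.prems svt_support[OF assms(2)] by blast
    then have "(i, j) \<in> diagram lam"
      using False partition_nth_mono[OF assms(1), of "i - 1" i] by (auto simp: mem_diagram)
    then obtain u where u: "u \<in> T (i, j)" using svt_support[OF assms(2)] by blast
    then have "u < s" using svt_column[OF assms(2) _ u Suc.prems] by simp
    then show ?thesis using Suc.IH[OF u] by simp
  qed
qed simp

lemma down_closed_interval:
  fixes J :: "nat set"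
  assumes "finite J" "\<And>j. j \<in> J \<Longrightarrow> 1 \<le> j" "\<And>j j'. j \<in> J \<Longrightarrow> 1 \<le> j' \<Longrightarrow> j' < j \<Longrightarrow> j' \<in> J"
  shows "J = {1..card J}"
proof (cases "J = {}")
  case False
  have "J \<subseteq> {1..Max J}" using assms(1,2) Max_ge by auto
  moreover have "j \<in> J" if "j \<in> {1..Max J}" for j
    using that assms(3)[of "Max J" j] Max_in[OF assms(1) False] by (cases "j = Max J") auto
  ultimately have "J = {1..Max J}" by blast
  then show ?thesis by (metis card_atLeastAtMost diff_Suc_1)
qed simp

text \<open>
  A tableau of shape \<open>\<lambda>\<close> arises from one of an interlacing shape by filling the strip \<open>\<lambda>/\<mu>\<close> with
  the new largest entry and adding this entry at any set of corners.
\<close>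
lemma insert_entry_svt:
  assumes lam: "is_partition lam" "length lam = Suc k" and mu: "mu \<in> interlacing lam"
    and T: "T \<in> svt mu k" and E: "E \<subseteq> corners lam mu"
  shows "insert_entry (Suc k) ((diagram lam - diagram mu) \<union> E) T \<in> svt lam (Suc k)" (is "?T \<in> _")
proof -
  have len: "length mu = k" and il: "\<And>i. i < k \<Longrightarrow> lam ! Suc i \<le> mu ! i \<and> mu ! i \<le> lam ! i"
    using mu lam(2) by (auto simp: interlacing_def)
  have sub: "T \<alpha> \<subseteq> {1..k}" and supp: "T \<alpha> \<noteq> {} \<longleftrightarrow> \<alpha> \<in> diagram mu" for \<alpha>
    by (rule svt_subset[OF T], rule svt_support[OF T])
  have mul: "diagram mu \<subseteq> diagram lam"
    by (rule interlacing_diagram[OF mu])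
  have Emu: "E \<subseteq> diagram mu" using E corners_subset by blast
  \<comment> \<open>A square with another one below it never receives the largest entry.\<close>
  have above: "(i, j) \<in> diagram mu \<and> Suc k \<notin> ?T (i, j)"
    if i: "1 \<le> i" "i < i'" and l: "(i', j) \<in> diagram lam" for i i' j
  proof -
    have "i \<le> k" "1 \<le> j" using l i lam(2) by (auto simp: mem_diagram)
    moreover have "j \<le> lam ! (i' - 1)" "i \<le> i' - 1" "i' - 1 < length lam"
      using l i by (auto simp: mem_diagram)
    then have "j \<le> lam ! i"
      using partition_nth_mono[OF lam(1), of i "i' - 1"] by simp
    moreover have "lam ! i \<le> mu ! (i - 1)" using il[of "i - 1"] i \<open>i \<le> k\<close> by simp
    ultimately have d: "(i, j) \<in> diagram mu" and "(i, j) \<notin> corners lam mu"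
      using i len by (auto simp: mem_diagram mem_corners)
    then show ?thesis using E sub[of "(i, j)"] by (auto simp: insert_entry_def)
  qed
  show ?thesis
  proof (rule svtI)
    fix \<alpha>
    show "?T \<alpha> \<subseteq> {1..Suc k}" using sub[of \<alpha>] by (auto simp: insert_entry_def)
    show "?T \<alpha> \<noteq> {} \<longleftrightarrow> \<alpha> \<in> diagram lam"
      using supp[of \<alpha>] mul Emu by (auto simp: insert_entry_def)
  next
    fix i j j' s t assume lt: "j < j'" and s: "s \<in> ?T (i, j)" and t: "t \<in> ?T (i, j')"
    show "s \<le> t"
    proof (cases "t \<in> T (i, j')")
      case True
      then have m: "(i, j') \<in> diagram mu" using supp by blast
      have "(i, j) \<in> diagram lam" using s supp[of "(i, j)"] mul Emu by (auto simp: insert_entry_def split: if_splits)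
      then have "(i, j) \<in> diagram mu" "(i, j) \<notin> corners lam mu"
        using m lt by (auto simp: mem_diagram mem_corners)
      then have "s \<in> T (i, j)" using s E by (auto simp: insert_entry_def split: if_splits)
      then show ?thesis using svt_row[OF T lt _ True] by blast
    next
      case False
      then have "t = Suc k" using t by (auto simp: insert_entry_def split: if_splits)
      then show ?thesis using s sub[of "(i, j)"] by (force simp: insert_entry_def split: if_splits)
    qed
  next
    fix i i' j s t assume lt: "i < i'" and s: "s \<in> ?T (i, j)" and t: "t \<in> ?T (i', j)"
    have "(i', j) \<in> diagram lam" "(i, j) \<in> diagram lam"
      using s t supp[of "(i, j)"] supp[of "(i', j)"] mul Emu by (auto simp: insert_entry_def split: if_splits)
    then have "(i, j) \<in> diagram mu" "Suc k \<notin> ?T (i, j)"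
      using above[of i i' j] lt by (auto simp: mem_diagram)
    then have sT: "s \<in> T (i, j)" using s by (auto simp: insert_entry_def split: if_splits)
    show "s < t"
    proof (cases "t \<in> T (i', j)")
      case True
      then show ?thesis using svt_column[OF T lt sT] by blast
    next
      case False
      then have "t = Suc k" using t by (auto simp: insert_entry_def split: if_splits)
      then show ?thesis using sT sub[of "(i, j)"] by force
    qed
  qed
qed

text \<open>
  Counting squares gives the row lengths because the squares with an entry other than \<open>k + 1\<close> form
  an initial segment of each row of a tableau.
\<close>
definition inner_shape :: "nat \<Rightarrow> (nat \<times> nat \<Rightarrow> nat set) \<Rightarrow> nat list" where
  "inner_shape k T = map (\<lambda>i. card {j. T (Suc i, j) - {Suc k} \<noteq> {}}) [0..<k]"

lemma inner_shape_eq: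
  assumes "length mu = k" "\<And>\<alpha>. T \<alpha> - {Suc k} \<noteq> {} \<longleftrightarrow> \<alpha> \<in> diagram mu"
  shows "inner_shape k T = mu"
proof (rule nth_equalityI)
  fix i assume "i < length (inner_shape k T)"
  then have i: "i < k" by (simp add: inner_shape_def)
  have "{j. T (Suc i, j) - {Suc k} \<noteq> {}} = {1..mu ! i}"
    unfolding assms(2) using i assms(1) by (auto simp: mem_diagram)
  then show "inner_shape k T ! i = mu ! i" using i by (simp add: inner_shape_def)
qed (simp add: inner_shape_def assms)

text \<open>
  Conversely, deleting the largest entry leaves a tableau of an interlacing shape, and the deleted
  occurrences fill the strip and some corners. Along a row the entries weakly increase, so the
  squares retaining an entry form an initial segment; a square above another one of \<open>\<lambda>\<close> retains
  all its entries, which gives the interlacing inequalities.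
\<close>
lemma remove_entry_svt:
  assumes lam: "is_partition lam" "length lam = Suc k" and T: "T \<in> svt lam (Suc k)"
  defines "mu \<equiv> inner_shape k T" and "E \<equiv> {\<alpha>. Suc k \<in> T \<alpha> \<and> T \<alpha> \<noteq> {Suc k}}"
  shows "mu \<in> interlacing lam" "(\<lambda>\<alpha>. T \<alpha> - {Suc k}) \<in> svt mu k" "E \<subseteq> corners lam mu"
    "insert_entry (Suc k) ((diagram lam - diagram mu) \<union> E) (\<lambda>\<alpha>. T \<alpha> - {Suc k}) = T"
proof -
  let ?T = "\<lambda>\<alpha>. T \<alpha> - {Suc k}"
  have sub: "T \<alpha> \<subseteq> {1..Suc k}" and supp: "T \<alpha> \<noteq> {} \<longleftrightarrow> \<alpha> \<in> diagram lam" for \<alpha>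
    by (rule svt_subset[OF T], rule svt_support[OF T])
  note row = svt_row[OF T] and col = svt_column[OF T]
  define J where "J i = {j. ?T (Suc i, j) \<noteq> {}}" for i
  have len: "length mu = k" by (simp add: mu_def inner_shape_def)
  have Jl: "J i \<subseteq> {1..lam ! i}" for i
  proof
    fix j assume "j \<in> J i"
    then have "T (Suc i, j) \<noteq> {}" by (auto simp: J_def)
    then show "j \<in> {1..lam ! i}" unfolding supp by (simp add: mem_diagram)
  qed
  have "J i = {1..card (J i)}" for i
  proof (rule down_closed_interval)
    show "finite (J i)" using Jl by (rule finite_subset) simp
    show "1 \<le> j" if "j \<in> J i" for j using Jl that by force
    fix j j' assume j: "j \<in> J i" and j': "1 \<le> j'" "j' < j"
    then obtain s where s: "s \<in> T (Suc i, j)" "s \<noteq> Suc k" by (auto simp: J_def)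
    then have "s < Suc k" using sub[of "(Suc i, j)"] by force
    have "(Suc i, j') \<in> diagram lam" using s supp[of "(Suc i, j)"] j' by (auto simp: mem_diagram)
    then obtain u where u: "u \<in> T (Suc i, j')" using supp by blast
    then have "u \<le> s" using row j' s by blast
    then show "j' \<in> J i" using u \<open>s < Suc k\<close> by (auto simp: J_def)
  qed
  moreover have "mu ! i = card (J i)" if "i < k" for i
    using that by (simp add: mu_def inner_shape_def J_def)
  ultimately have J: "J i = {1..mu ! i}" if "i < k" for i using that by metis
  have supp': "?T \<alpha> \<noteq> {} \<longleftrightarrow> \<alpha> \<in> diagram mu" for \<alpha>
  proof (cases \<alpha>)
    case (Pair i j)
    show ?thesis
    proof (cases "1 \<le> i \<and> i \<le> k")
      case True
      have "?T \<alpha> \<noteq> {} \<longleftrightarrow> j \<in> J (i - 1)" using True by (simp add: J_def Pair)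
      also have "\<dots> \<longleftrightarrow> \<alpha> \<in> diagram mu" using True len by (auto simp: J Pair mem_diagram)
      finally show ?thesis .
    next
      case False
      have "?T \<alpha> = {}"
      proof (rule ccontr)
        assume "?T \<alpha> \<noteq> {}"
        then obtain s where s: "s \<in> T (i, j)" "s \<noteq> Suc k" by (auto simp: Pair)
        then have "(i, j) \<in> diagram lam" "s \<le> Suc k" using supp sub[of "(i, j)"] by auto
        then have "i = Suc k" "s \<le> k" using False s lam(2) by (auto simp: mem_diagram)
        then show False using row_le_entry[OF lam(1) T s(1)] by simp
      qed
      then show ?thesis using False len by (auto simp: Pair mem_diagram)
    qed
  qed
  have "lam ! Suc i \<le> mu ! i \<and> mu ! i \<le> lam ! i" if i: "i < k" for i
  proof
    show "mu ! i \<le> lam ! i" using Jl[of i] J[OF i] by (cases "mu ! i") auto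
    have "j \<in> J i" if "j \<in> {1..lam ! Suc i}" for j
    proof -
      have "(Suc (Suc i), j) \<in> diagram lam" "(Suc i, j) \<in> diagram lam"
        using that i lam(2) partition_nth_mono[OF lam(1), of i "Suc i"] by (auto simp: mem_diagram)
      then obtain s t where st: "s \<in> T (Suc i, j)" "t \<in> T (Suc (Suc i), j)" using supp by blast
      then have "s < t" "t \<le> Suc k" using col[OF _ st] sub[of "(Suc (Suc i), j)"] by auto
      then show ?thesis using st by (auto simp: J_def)
    qed
    then have "{1..lam ! Suc i} \<subseteq> {1..mu ! i}" unfolding J[OF i] by blast
    then show "lam ! Suc i \<le> mu ! i" by (cases "lam ! Suc i") auto
  qed
  then show il: "mu \<in> interlacing lam" using len lam(2) by (simp add: interlacing_def)
  have sub': "?T \<alpha> \<subseteq> {1..k}" for \<alpha> using sub[of \<alpha>] by (force simp: le_Suc_eq)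
  then show "?T \<in> svt mu k" by (rule svtI) (use supp' in \<open>auto intro: row col\<close>)
  show "E \<subseteq> corners lam mu"
  proof
    fix \<alpha> assume \<alpha>: "\<alpha> \<in> E"
    obtain i j where ij: "\<alpha> = (i, j)" by (cases \<alpha>)
    have n: "Suc k \<in> T (i, j)" and "?T \<alpha> \<noteq> {}" using \<alpha> by (auto simp: E_def ij)
    then have d: "1 \<le> i" "i \<le> k" "1 \<le> j" "j \<le> mu ! (i - 1)"
      using supp'[of \<alpha>] len by (auto simp: ij mem_diagram)
    have "\<not> j < mu ! (i - 1)"
    proof
      assume "j < mu ! (i - 1)"
      then have "(i, Suc j) \<in> diagram mu" using d len by (simp add: mem_diagram)
      then obtain s where "s \<in> ?T (i, Suc j)" using supp' by blast
      then have "s \<in> T (i, Suc j)" "s \<le> k" using sub'[of "(i, Suc j)"] by auto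
      then show False using row[OF _ n, of "Suc j" s] by simp
    qed
    moreover have "\<not> j \<le> lam ! i"
    proof
      assume "j \<le> lam ! i"
      then have "(Suc i, j) \<in> diagram lam" using d lam(2) by (simp add: mem_diagram)
      then obtain s where s: "s \<in> T (Suc i, j)" using supp by blast
      then show False using col[OF _ n, of "Suc i" s] sub[of "(Suc i, j)"] by force
    qed
    ultimately show "\<alpha> \<in> corners lam mu" using d len by (auto simp: ij mem_corners)
  qed
  show "insert_entry (Suc k) ((diagram lam - diagram mu) \<union> E) ?T = T"
  proof
    fix \<alpha>
    show "insert_entry (Suc k) ((diagram lam - diagram mu) \<union> E) ?T \<alpha> = T \<alpha>"
      using supp[of \<alpha>] supp'[of \<alpha>] by (cases "T \<alpha> = {Suc k}") (auto simp: insert_entry_def E_def)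
  qed
qed

lemma insert_entry_weight:
  assumes lam: "length lam = Suc k" and mu: "mu \<in> interlacing lam"
    and T: "T \<in> svt mu k" and E: "E \<subseteq> corners lam mu"
  shows "(\<Prod>\<alpha>\<in>diagram lam. cell_weight \<beta> x y \<alpha> (insert_entry (Suc k) ((diagram lam - diagram mu) \<union> E) T \<alpha>)) =
    (\<Prod>\<alpha>\<in>diagram lam - diagram mu. entry_weight \<beta> x y \<alpha> (Suc k)) *
    (\<Prod>\<alpha>\<in>diagram mu. cell_weight \<beta> x y \<alpha> (T \<alpha>)) * (\<Prod>\<alpha>\<in>E. \<beta> * entry_weight \<beta> x y \<alpha> (Suc k))"
proof -
  let ?T = "insert_entry (Suc k) ((diagram lam - diagram mu) \<union> E) T"
  have sub: "T \<alpha> \<subseteq> {1..k}" and supp: "T \<alpha> \<noteq> {} \<longleftrightarrow> \<alpha> \<in> diagram mu" for \<alpha>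
    by (rule svt_subset[OF T], rule svt_support[OF T])
  then have fin: "finite (T \<alpha>)" for \<alpha> using finite_subset by blast
  have new: "Suc k \<notin> T \<alpha>" for \<alpha> using sub[of \<alpha>] by auto
  have mul: "diagram mu \<subseteq> diagram lam"
    by (rule interlacing_diagram[OF mu])
  have Emu: "E \<subseteq> diagram mu" using E corners_subset by blast
  have out: "cell_weight \<beta> x y \<alpha> (?T \<alpha>) = entry_weight \<beta> x y \<alpha> (Suc k)"
    if "\<alpha> \<in> diagram lam - diagram mu" for \<alpha>
    using that supp[of \<alpha>] by (simp add: insert_entry_def cell_weight_def)
  have ins: "cell_weight \<beta> x y \<alpha> (?T \<alpha>) = cell_weight \<beta> x y \<alpha> (T \<alpha>) *
      (if \<alpha> \<in> E then \<beta> * entry_weight \<beta> x y \<alpha> (Suc k) else 1)" if "\<alpha> \<in> diagram mu" for \<alpha>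
  proof (cases "\<alpha> \<in> E")
    case True
    have "card (T \<alpha>) \<noteq> 0" using supp[of \<alpha>] fin[of \<alpha>] that by simp
    then obtain c where "card (T \<alpha>) = Suc c" using not0_implies_Suc by blast
    then show ?thesis using True fin new that by (simp add: insert_entry_def cell_weight_def)
  qed (use that in \<open>simp add: insert_entry_def\<close>)
  have "(\<Prod>\<alpha>\<in>diagram lam. cell_weight \<beta> x y \<alpha> (?T \<alpha>)) =
      (\<Prod>\<alpha>\<in>diagram lam - diagram mu. cell_weight \<beta> x y \<alpha> (?T \<alpha>)) *
      (\<Prod>\<alpha>\<in>diagram mu. cell_weight \<beta> x y \<alpha> (?T \<alpha>))"
    using mul by (intro prod.subset_diff) simp_all
  also have "(\<Prod>\<alpha>\<in>diagram mu. cell_weight \<beta> x y \<alpha> (?T \<alpha>)) =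
      (\<Prod>\<alpha>\<in>diagram mu. cell_weight \<beta> x y \<alpha> (T \<alpha>)) *
      (\<Prod>\<alpha>\<in>diagram mu. if \<alpha> \<in> E then \<beta> * entry_weight \<beta> x y \<alpha> (Suc k) else 1)"
    by (simp add: ins prod.distrib)
  also have "(\<Prod>\<alpha>\<in>diagram mu. if \<alpha> \<in> E then \<beta> * entry_weight \<beta> x y \<alpha> (Suc k) else 1) =
      (\<Prod>\<alpha>\<in>E. \<beta> * entry_weight \<beta> x y \<alpha> (Suc k))"
    using Emu by (simp add: prod.If_cases Int_absorb1)
  finally show ?thesis by (simp add: out mult.assoc)
qed

text \<open>
  The expansion of the product over the corners runs over the sets of corners that receive the
  largest entry. Row by row the product is the weight used for bialternants; the last row,
  which contains only the largest entry, gives the factorial power.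
\<close>
lemma branch_weight_cells:
  assumes lam: "length lam = Suc k" and mu: "mu \<in> interlacing lam"
  shows "(\<Prod>\<alpha>\<in>diagram lam - diagram mu. entry_weight \<beta> x y \<alpha> (Suc k)) *
      (\<Prod>\<alpha>\<in>corners lam mu. \<beta> * entry_weight \<beta> x y \<alpha> (Suc k) + 1) =
    factorial_power \<beta> y (x (Suc k)) (last lam) * branch_weight \<beta> y (x (Suc k)) lam mu"
proof -
  let ?z = "x (Suc k)"
  have len: "length mu = k" using mu lam by (simp add: interlacing_def)
  have e: "entry_weight \<beta> x y (Suc i, c) (Suc k) = oplus \<beta> ?z (y (c + (k - i)))" if "i \<le> k" for i c
  proof -
    have "nat (int (Suc k) + content (Suc i, c)) = c + (k - i)" using that by (simp add: content_def)
    then show ?thesis by (simp add: entry_weight_def)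
  qed
  have "diagram lam - diagram mu =
      (\<lambda>(i, j). (Suc i, j)) ` (SIGMA i:{..<Suc k}. {(mu @ [0]) ! i<..lam ! i})"
  proof (intro set_eqI iffI)
    fix \<alpha> assume a: "\<alpha> \<in> diagram lam - diagram mu"
    then obtain i j where "\<alpha> = (Suc i, j)" "i < Suc k"
      using lam by (cases \<alpha>; cases "fst \<alpha>") (auto simp: mem_diagram)
    with a show "\<alpha> \<in> (\<lambda>(i, j). (Suc i, j)) ` (SIGMA i:{..<Suc k}. {(mu @ [0]) ! i<..lam ! i})"
      using len by (auto simp: mem_diagram nth_append image_iff less_Suc_eq)
  qed (use len lam in \<open>auto simp: mem_diagram nth_append less_Suc_eq\<close>)
  then have "(\<Prod>\<alpha>\<in>diagram lam - diagram mu. entry_weight \<beta> x y \<alpha> (Suc k)) =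
      (\<Prod>i<Suc k. \<Prod>c\<in>{(mu @ [0]) ! i<..lam ! i}. entry_weight \<beta> x y (Suc i, c) (Suc k))"
    by (simp only:)
      (subst prod.Sigma, simp_all del: prod.lessThan_Suc add: prod.reindex inj_on_def case_prod_beta)
  also have "\<dots> = (\<Prod>i<k. \<Prod>c\<in>{mu ! i<..lam ! i}. oplus \<beta> ?z (y (c + (k - i)))) * factorial_power \<beta> y ?z (last lam)"
  proof -
    have "{0<..lam ! k} = {1..lam ! k}" by auto
    moreover have "last lam = lam ! k" using lam by (subst last_conv_nth) auto
    ultimately have "(\<Prod>c\<in>{(mu @ [0]) ! k<..lam ! k}. entry_weight \<beta> x y (Suc k, c) (Suc k)) =
        factorial_power \<beta> y ?z (last lam)"
      using len by (simp add: e factorial_power_def nth_append)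
    then show ?thesis using len by (simp add: e nth_append factorial_power_def)
  qed
  finally have 1: "(\<Prod>\<alpha>\<in>diagram lam - diagram mu. entry_weight \<beta> x y \<alpha> (Suc k)) = \<dots>" .
  have "(\<Prod>\<alpha>\<in>corners lam mu. \<beta> * entry_weight \<beta> x y \<alpha> (Suc k) + 1) =
      (\<Prod>i | i < k \<and> lam ! Suc i < mu ! i. 1 + \<beta> * oplus \<beta> ?z (y (mu ! i + (k - i))))"
    unfolding corners_def len
    by (subst prod.reindex) (auto simp: inj_on_def e add.commute intro!: prod.cong)
  also have "\<dots> = (\<Prod>i<k. if lam ! Suc i < mu ! i then 1 + \<beta> * oplus \<beta> ?z (y (mu ! i + (k - i))) else 1)"
    by (simp add: prod.If_cases) (rule prod.cong, auto)
  finally show ?thesis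
    unfolding 1 branch_weight_def row_weight_def len lam diff_Suc_Suc prod.distrib
    by (simp add: mult_ac)
qed

text \<open>
  Tableaux of shape \<open>\<lambda>\<close> correspond to triples of an interlacing shape \<open>\<mu>\<close>, a tableau of shape
  \<open>\<mu>\<close> in the smaller entries, and a set of corners; weights multiply.
\<close>
theorem grothendieck_branching:
  assumes lam: "is_partition lam" "length lam = Suc k"
  shows "grothendieck \<beta> (Suc k) lam x y =
    (\<Sum>mu\<in>interlacing lam. factorial_power \<beta> y (x (Suc k)) (last lam) * branch_weight \<beta> y (x (Suc k)) lam mu *
       grothendieck \<beta> k mu x y)"
proof -
  let ?e = "\<lambda>\<alpha>. entry_weight \<beta> x y \<alpha> (Suc k)"
  let ?w = "\<lambda>lam T. \<Prod>\<alpha>\<in>diagram lam. cell_weight \<beta> x y \<alpha> (T \<alpha>)"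
  let ?o = "\<lambda>mu. \<Prod>\<alpha>\<in>diagram lam - diagram mu. ?e \<alpha>"
  define glue where "glue = (\<lambda>(mu, T, E). insert_entry (Suc k) ((diagram lam - diagram mu) \<union> E) T)"
  define cut where "cut T = (inner_shape k T, \<lambda>\<alpha>. T \<alpha> - {Suc k}, {\<alpha>. Suc k \<in> T \<alpha> \<and> T \<alpha> \<noteq> {Suc k}})" for T
  let ?D = "SIGMA mu:interlacing lam. svt mu k \<times> Pow (corners lam mu)"
  have "grothendieck \<beta> (Suc k) lam x y = (\<Sum>T\<in>svt lam (Suc k). ?w lam T)"
    by (rule grothendieck_cell_weights)
  also have "\<dots> = (\<Sum>(mu, T, E)\<in>?D. ?o mu * ?w mu T * (\<Prod>\<alpha>\<in>E. \<beta> * ?e \<alpha>))"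
  proof (rule sum.reindex_bij_witness[where i = glue and j = cut])
    fix T assume T: "T \<in> svt lam (Suc k)"
    note rem = remove_entry_svt[OF lam T]
    show "glue (cut T) = T" using rem(4) by (simp add: glue_def cut_def)
    show "cut T \<in> ?D" using rem by (simp add: cut_def)
    show "(case cut T of (mu, T, E) \<Rightarrow> ?o mu * ?w mu T * (\<Prod>\<alpha>\<in>E. \<beta> * ?e \<alpha>)) = ?w lam T"
      using insert_entry_weight[OF lam(2) rem(1-3), of \<beta> x y] by (simp add: cut_def rem(4))
  next
    fix p assume "p \<in> ?D"
    then obtain mu T E where p: "p = (mu, T, E)" "mu \<in> interlacing lam" "T \<in> svt mu k"
      "E \<subseteq> corners lam mu" by auto
    let ?T = "insert_entry (Suc k) ((diagram lam - diagram mu) \<union> E) T"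
    have sub: "T \<alpha> \<subseteq> {1..k}" and supp: "T \<alpha> \<noteq> {} \<longleftrightarrow> \<alpha> \<in> diagram mu" for \<alpha>
      by (rule svt_subset[OF p(3)], rule svt_support[OF p(3)])
    have new: "Suc k \<notin> T \<alpha>" for \<alpha> using sub[of \<alpha>] by auto
    show "glue p \<in> svt lam (Suc k)"
      using insert_entry_svt[OF lam p(2-4)] by (simp add: glue_def p)
    have rest: "?T \<alpha> - {Suc k} = T \<alpha>" for \<alpha> using new[of \<alpha>] by (auto simp: insert_entry_def)
    have "inner_shape k ?T = mu"
      using p(2) lam(2) by (intro inner_shape_eq) (simp_all only: rest supp, simp add: interlacing_def)
    moreover have "{\<alpha>. Suc k \<in> ?T \<alpha> \<and> ?T \<alpha> \<noteq> {Suc k}} = E"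
    proof -
      have "(Suc k \<in> ?T \<alpha> \<and> ?T \<alpha> \<noteq> {Suc k}) \<longleftrightarrow> \<alpha> \<in> E" for \<alpha>
        using new[of \<alpha>] supp[of \<alpha>] p(4) corners_subset[of lam mu] by (auto simp: insert_entry_def)
      then show ?thesis by blast
    qed
    ultimately show "cut (glue p) = p" by (simp add: cut_def glue_def p rest)
  qed
  also have "\<dots> = (\<Sum>mu\<in>interlacing lam. \<Sum>T\<in>svt mu k. \<Sum>E\<in>Pow (corners lam mu).
      ?o mu * ?w mu T * (\<Prod>\<alpha>\<in>E. \<beta> * ?e \<alpha>))"
    by (simp add: sum.Sigma sum.cartesian_product)
  also have "\<dots> = (\<Sum>mu\<in>interlacing lam. ?o mu * (\<Prod>\<alpha>\<in>corners lam mu. \<beta> * ?e \<alpha> + 1) *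
      grothendieck \<beta> k mu x y)"
    by (intro sum.cong refl)
      (simp add: prod_add grothendieck_cell_weights sum_distrib_left sum_distrib_right mult_ac,
       rule sum.swap)
  also have "\<dots> = (\<Sum>mu\<in>interlacing lam. factorial_power \<beta> y (x (Suc k)) (last lam) *
      branch_weight \<beta> y (x (Suc k)) lam mu * grothendieck \<beta> k mu x y)"
    by (simp add: branch_weight_cells[OF lam(2)])
  finally show ?thesis .
qed

section \<open>The determinantal formula\<close>

lemma interlacing_partition:
  assumes "is_partition lam" "mu \<in> interlacing lam"
  shows "is_partition mu"
proof -
  have "mu ! j \<le> mu ! i" if "i < j" "j < length mu" for i j
  proof -
    have "mu ! j \<le> lam ! j" "lam ! Suc i \<le> mu ! i" "length lam = Suc (length mu)"
      using assms(2) that by (auto simp: interlacing_def)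
    moreover have "lam ! j \<le> lam ! Suc i"
      using that calculation by (intro partition_nth_mono[OF assms(1)]) auto
    ultimately show ?thesis by linarith
  qed
  then show ?thesis by (simp add: is_partition_def sorted_wrt_iff_nth_less)
qed

lemma grothendieck_empty_diagram:
  assumes "diagram lam = {}"
  shows "grothendieck \<beta> n lam x y = 1"
proof -
  have "svt lam n = {\<lambda>_. {}}"
    using svt_support[of _ lam n] assms by (auto simp: fun_eq_iff intro: svtI)
  then show ?thesis using assms by (simp add: grothendieck_cell_weights)
qed

text \<open>
  Both sides satisfy the same branching rule when the last variable is split off. As the right-hand
  side depends only on the set of the variables, the formula also yields the symmetry of the
  polynomial.
\<close>
theorem grothendieck_bialternant:
  assumes "is_partition lam" "length lam = n" "inj_on x {1..n}"
  shows "grothendieck \<beta> n lam x y = bialternant (columns \<beta> y 0 (row_exponents lam)) (x ` {1..n})"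
  using assms
proof (induction n arbitrary: lam)
  case 0
  then show ?case by (simp add: grothendieck_empty_diagram diagram_def)
next
  case (Suc n)
  let ?Y = "x ` {1..n}"
  have ins: "{1..Suc n} = insert (Suc n) {1..n}" by auto
  then have inj: "inj_on x {1..n}" and z: "x (Suc n) \<notin> ?Y"
    using Suc.prems(3)[unfolded ins] by simp_all
  have "grothendieck \<beta> n mu x y = bialternant (columns \<beta> y 0 (row_exponents mu)) ?Y" if "mu \<in> interlacing lam" for mu
    using Suc.IH[OF _ _ inj] interlacing_partition[OF Suc.prems(1) that] that Suc.prems(2)
    by (simp add: interlacing_def)
  moreover have "length lam = Suc (card ?Y)"
    using Suc.prems(2) inj by (simp add: card_image)
  ultimately show ?case
    unfolding ins image_insert grothendieck_branching[OF Suc.prems(1,2)]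
    using bialternant_branching[OF Suc.prems(1) _ _ z, of \<beta> y] by simp
qed

section \<open>The sum over subsets of the variables\<close>

lemma columns_shift:
  "columns \<beta> y (k + r) es = map (\<lambda>C a. (1 + \<beta> * a) ^ k * C a) (columns \<beta> y r es)"
  by (induction es arbitrary: r) (simp_all add: power_add mult_ac flip: add_Suc_right)

text \<open>
  The factor \<open>(1 + \<beta> b)\<^sup>k\<close> comes out of every row, and what remains is the determinantal formula for
  the empty partition.
\<close>
lemma bialternant_zero_columns:
  assumes "finite B"
  shows "bialternant (columns \<beta> y k (row_exponents (replicate (card B) 0))) B = (\<Prod>b\<in>B. (1 + \<beta> * b) ^ k)"
proof -
  let ?zs = "replicate (card B) (0 :: nat)"
  obtain h where h: "bij_betw h {1..card B} B"
    using ex_bij_betw_nat_finite_1[OF assms] by blast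
  have "bialternant (columns \<beta> y 0 (row_exponents ?zs)) B = grothendieck \<beta> (card B) ?zs h y"
    using grothendieck_bialternant[of ?zs "card B" h] h
    by (simp add: bij_betw_def is_partition_def sorted_wrt_iff_nth_less)
  also have "\<dots> = 1"
    by (rule grothendieck_empty_diagram) (auto simp: diagram_def)
  finally show ?thesis
    using assms columns_shift[of \<beta> y k 0] by (simp add: bialternant_factor)
qed

lemma grothendieck_append_zeros:
  "grothendieck \<beta> n (lam @ replicate r 0) x y = grothendieck \<beta> n lam x y"
proof -
  have d: "diagram (lam @ replicate r 0) = diagram lam"
    by (auto simp: diagram_def nth_append split: if_splits)
  have "svt (lam @ replicate r 0) n = svt lam n"
    by (simp add: svt_def set_valued_tableau_def d)
  then show ?thesis by (simp add: grothendieck_cell_weights d)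
qed

text \<open>
  Appending \<open>m\<close> zero parts raises the exponents of the other parts by \<open>m\<close>, which undoes the
  subtraction of \<open>n - k = m\<close> from the parts of the partition.
\<close>
lemma row_exponents_append_zeros:
  "row_exponents (lam @ replicate m 0) = row_exponents (map (\<lambda>p. p + m) lam) @ row_exponents (replicate m 0)"
  by (induction lam) simp_all

lemma row_exponents_last: "lam \<noteq> [] \<Longrightarrow> \<exists>es. row_exponents lam = es @ [last lam]"
  by (induction lam) auto

lemma set_row_exponents_zeros: "set (row_exponents (replicate m 0)) = {..<m}"
  by (induction m) (auto simp: lessThan_Suc)

lemma columns_beta_zero: "columns 0 y r es = map (\<lambda>e a. factorial_power 0 y a e) es"
  by (induction es arbitrary: r) simp_all

lemma subvars_image:
  assumes "finite S" "card S = k"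
  shows "subvars x S ` {1..k} = x ` S" and "inj_on x S \<Longrightarrow> inj_on (subvars x S) {1..k}"
proof -
  let ?xs = "sorted_list_of_set S"
  have xs: "set ?xs = S" "distinct ?xs" "length ?xs = k" using assms by auto
  have "(\<lambda>t. ?xs ! (t - 1)) ` {1..k} = (!) ?xs ` {..<k}"
    by (force simp: image_iff)
  also have "\<dots> = S" using xs by (metis lessThan_atLeast0 list.set_map map_nth set_upt)
  finally have im: "(\<lambda>t. ?xs ! (t - 1)) ` {1..k} = S" .
  have sv: "subvars x S = x \<circ> (\<lambda>t. ?xs ! (t - 1))" by (simp add: fun_eq_iff subvars_def)
  show "subvars x S ` {1..k} = x ` S" unfolding sv image_comp[symmetric] im ..
  have "inj_on (\<lambda>t. ?xs ! (t - 1)) {1..k}"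
    by (rule eq_card_imp_inj_on) (unfold im, simp_all add: assms(2))
  then show "inj_on (subvars x S) {1..k}" if "inj_on x S"
    unfolding sv using that im by (intro comp_inj_on) simp_all
qed

text \<open>
  Each summand is a product in a Laplace expansion: the columns belonging to \<open>\<lambda>\<close> are evaluated on
  the chosen variables, and those of \<open>n - k\<close> zero parts, starting with \<open>(1 + \<beta> a)\<^sup>k\<close>, on the
  others.
\<close>
theorem subset_sum_bialternant:
  assumes lam: "is_partition lam" "length lam = k" and inj: "inj_on x {1..n}"
  shows "(\<Sum>S | S \<subseteq> {1..n} \<and> card S = k.
            grothendieck \<beta> k lam (subvars x S) y *
              ((\<Prod>j\<in>{1..n} - S. (1 + \<beta> * x j) ^ k) /
               (\<Prod>i\<in>S. \<Prod>j\<in>{1..n} - S. x i - x j))) =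
    bialternant (columns \<beta> y 0 (row_exponents lam @ row_exponents (replicate (n - k) 0))) (x ` {1..n})"
proof -
  let ?X = "x ` {1..n}"
  let ?Cs = "columns \<beta> y 0 (row_exponents lam)" and ?Ds = "columns \<beta> y k (row_exponents (replicate (n - k) 0))"
  have "bialternant (columns \<beta> y 0 (row_exponents lam @ row_exponents (replicate (n - k) 0))) ?X = bialternant (?Cs @ ?Ds) ?X"
    using lam by (simp add: columns_append)
  also have "\<dots> = (\<Sum>A | A \<subseteq> ?X \<and> card A = k.
      bialternant ?Cs A * bialternant ?Ds (?X - A) / (\<Prod>a\<in>A. \<Prod>b\<in>?X - A. a - b))"
    using lam by (simp add: bialternant_append)
  also have "\<dots> = (\<Sum>S | S \<subseteq> {1..n} \<and> card S = k.
      bialternant ?Cs (x ` S) * bialternant ?Ds (?X - x ` S) / (\<Prod>a\<in>x ` S. \<Prod>b\<in>?X - x ` S. a - b))"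
  proof (rule sum.reindex_cong[where l = "image x"])
    show "inj_on ((`) x) {S. S \<subseteq> {1..n} \<and> card S = k}"
      by (rule inj_onI) (use inj_on_image_eq_iff[OF inj] in blast)
    have c: "card (x ` S) = card S" if "S \<subseteq> {1..n}" for S
      using inj that by (meson card_image inj_on_subset)
    show "{A. A \<subseteq> ?X \<and> card A = k} = (`) x ` {S. S \<subseteq> {1..n} \<and> card S = k}"
    proof (intro set_eqI iffI)
      fix A assume "A \<in> {A. A \<subseteq> ?X \<and> card A = k}"
      then obtain S where S: "S \<subseteq> {1..n}" "A = x ` S" "card A = k"
        unfolding subset_image_iff by blast
      then have "card S = k" using c[OF S(1)] by simp
      with S(1) have "S \<in> {S. S \<subseteq> {1..n} \<and> card S = k}" by simp
      then show "A \<in> (`) x ` {S. S \<subseteq> {1..n} \<and> card S = k}"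
        unfolding S(2) by (rule imageI)
    next
      fix A assume "A \<in> (`) x ` {S. S \<subseteq> {1..n} \<and> card S = k}"
      then obtain S where S: "S \<subseteq> {1..n}" "card S = k" "A = x ` S" by blast
      then show "A \<in> {A. A \<subseteq> ?X \<and> card A = k}"
        using c[OF S(1)] image_mono[OF S(1)] by simp
    qed
  qed simp
  also have "\<dots> = (\<Sum>S | S \<subseteq> {1..n} \<and> card S = k.
      grothendieck \<beta> k lam (subvars x S) y *
        ((\<Prod>j\<in>{1..n} - S. (1 + \<beta> * x j) ^ k) / (\<Prod>i\<in>S. \<Prod>j\<in>{1..n} - S. x i - x j)))"
  proof (rule sum.cong[OF refl])
    fix S assume "S \<in> {S. S \<subseteq> {1..n} \<and> card S = k}"
    then have S: "S \<subseteq> {1..n}" "card S = k" "finite S" using finite_subset by auto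
    have injS: "inj_on x S" and injR: "inj_on x ({1..n} - S)"
      using inj S by (auto intro: inj_on_subset)
    have diff: "?X - x ` S = x ` ({1..n} - S)"
      using inj S by (simp add: inj_on_image_set_diff)
    have "card (x ` ({1..n} - S)) = n - k"
      using S injR by (simp add: card_image card_Diff_subset)
    then have "bialternant ?Ds (x ` ({1..n} - S)) = (\<Prod>j\<in>{1..n} - S. (1 + \<beta> * x j) ^ k)"
      using bialternant_zero_columns[of "x ` ({1..n} - S)" \<beta> y k] injR by (simp add: prod.reindex)
    moreover have "grothendieck \<beta> k lam (subvars x S) y = bialternant ?Cs (x ` S)"
      unfolding grothendieck_bialternant[OF lam subvars_image(2)[OF S(3,2) injS]]
        subvars_image(1)[OF S(3,2)] ..
    moreover have "(\<Prod>a\<in>x ` S. \<Prod>b\<in>x ` ({1..n} - S). a - b) = (\<Prod>i\<in>S. \<Prod>j\<in>{1..n} - S. x i - x j)"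
      using injS injR by (simp add: prod.reindex)
    ultimately show "bialternant ?Cs (x ` S) * bialternant ?Ds (?X - x ` S) / (\<Prod>a\<in>x ` S. \<Prod>b\<in>?X - x ` S. a - b) =
      grothendieck \<beta> k lam (subvars x S) y *
        ((\<Prod>j\<in>{1..n} - S. (1 + \<beta> * x j) ^ k) / (\<Prod>i\<in>S. \<Prod>j\<in>{1..n} - S. x i - x j))"
      unfolding diff by simp
  qed
  finally show ?thesis by simp
qed

theorem theorem2p1:
  fixes x y :: "nat \<Rightarrow> 'a::field" and \<beta> :: 'a and n k :: nat and lam :: "nat list"
  assumes "1 \<le> k" and "k \<le> n"
    and "is_partition lam" and "length lam = k"
    and "inj_on x {1..n}"
    and "int (lam ! (k - 1)) - int n + int k \<ge> 0 \<or> \<beta> = 0"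
  shows "(if int (lam ! (k - 1)) - int n + int k < 0 then 0
          else grothendieck \<beta> n (map (\<lambda>p. nat (int p - int n + int k)) lam) x y) =
         (\<Sum>S | S \<subseteq> {1..n} \<and> card S = k.
            grothendieck \<beta> k lam (subvars x S) y *
              ((\<Prod>j\<in>{1..n} - S. (1 + \<beta> * x j) ^ k) /
               (\<Prod>i\<in>S. \<Prod>j\<in>{1..n} - S. x i - x j)))"
proof -
  define m where "m = n - k"
  have n: "n = k + m" using assms(2) by (simp add: m_def)
  have nonempty: "lam \<noteq> []" using assms(1,4) by auto
  then have last: "last lam = lam ! (k - 1)" using assms(4) by (simp add: last_conv_nth)
  have rhs: "(\<Sum>S | S \<subseteq> {1..n} \<and> card S = k.
            grothendieck \<beta> k lam (subvars x S) y *
              ((\<Prod>j\<in>{1..n} - S. (1 + \<beta> * x j) ^ k) /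
               (\<Prod>i\<in>S. \<Prod>j\<in>{1..n} - S. x i - x j))) =
      bialternant (columns \<beta> y 0 (row_exponents lam @ row_exponents (replicate m 0))) (x ` {1..n})"
    unfolding m_def by (rule subset_sum_bialternant[OF assms(3-5)])
  show ?thesis
  proof (cases "m \<le> last lam")
    case True
    define mu where "mu = map (\<lambda>p. p - m) lam"
    have ge: "m \<le> p" if "p \<in> set lam" for p
    proof -
      obtain i where "i < k" "p = lam ! i" using \<open>p \<in> set lam\<close> assms(4) by (auto simp: in_set_conv_nth)
      then have "lam ! (k - 1) \<le> p" using assms(3,4) by (auto intro!: partition_nth_mono)
      with True show ?thesis by (simp add: last)
    qed
    have mu: "map (\<lambda>p. nat (int p - int n + int k)) lam = mu"
      unfolding mu_def using n by (auto intro!: map_cong)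
    have lam: "lam = map (\<lambda>p. p + m) mu"
      unfolding mu_def by (simp add: comp_def ge map_idI)
    have "is_partition (mu @ replicate m 0)"
    proof -
      have "sorted_wrt (\<ge>) mu" using assms(3) unfolding is_partition_def lam by (simp add: sorted_wrt_map)
      moreover have "sorted_wrt (\<ge>) (replicate m (0 :: nat))" by (induction m) simp_all
      ultimately show ?thesis by (simp add: is_partition_def sorted_wrt_append)
    qed
    then have "grothendieck \<beta> n (mu @ replicate m 0) x y =
        bialternant (columns \<beta> y 0 (row_exponents (mu @ replicate m 0))) (x ` {1..n})"
      using assms(4,5) n by (intro grothendieck_bialternant) (simp_all add: mu_def)
    then have "grothendieck \<beta> n mu x y =
        bialternant (columns \<beta> y 0 (row_exponents lam @ row_exponents (replicate m 0))) (x ` {1..n})"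
      by (simp add: grothendieck_append_zeros row_exponents_append_zeros lam[symmetric])
    moreover have "\<not> int (lam ! (k - 1)) - int n + int k < 0" using True n last by simp
    ultimately show ?thesis unfolding rhs mu by simp
  next
    case False
    then have neg: "int (lam ! (k - 1)) - int n + int k < 0" using n last by simp
    then have beta: "\<beta> = 0" using assms(6) by simp
    \<comment> \<open>For \<open>\<beta> = 0\<close> a column depends only on its exponent, and the exponent of the last part
      also occurs among those of the zero parts.\<close>
    let ?f = "\<lambda>e a. factorial_power 0 y a e"
    obtain es where es: "row_exponents lam = es @ [last lam]"
      using row_exponents_last[OF nonempty] by blast
    have "?f (last lam) \<in> set (map ?f (row_exponents (replicate m 0)))"
      using False by (auto simp: set_row_exponents_zeros)
    then have "bialternant (?f (last lam) # map ?f (row_exponents (replicate m 0))) T = 0 * bialternant [] T"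
      if "finite T" for T
      using that by (simp add: bialternant_repeated del: bialternant.simps)
    from bialternant_append_cong[OF this, of "x ` {1..n}" "map ?f es"]
    have "bialternant (columns \<beta> y 0 (row_exponents lam @ row_exponents (replicate m 0))) (x ` {1..n}) = 0"
      by (simp add: beta columns_beta_zero es)
    then show ?thesis unfolding rhs using neg by simp
  qed
qed

end
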